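(* Let $n\ge 1$ be an integer. The extended quotient $(\mathbb{T}^n/\mathbb{T})/\!/(\mathbb{Z}/n\mathbb{Z})$ is a disjoint union of compact connected orbifolds: $$(\mathbb{T}^n/\mathbb{T})/\!/(\mathbb{Z}/n\mathbb{Z}) \;=\; \bigsqcup \; \mathfrak{X}(n,k,\omega),$$ where the disjoint union is over all $1\le k\le n$ and all $n/(k,n)$th roots of unity $\omega$ in $\mathbb{C}$ (not necessarily primitive, $\omega=1$ included).
   Context: $\mathbb{T}=\{z\in\mathbb{C}:|z|=1\}$. $\mathbb{T}^n/\mathbb{T}$ is the quotient of $\mathbb{T}^n$ by the diagonal action $t(t_1,\dots,t_n)=(tt_1,\dots,tt_n)$ of $\mathbb{T}$. The group $\mathbb{Z}/n\mathbb{Z}$ acts on $\mathbb{T}^n$, and hence on $\mathbb{T}^n/\mathbb{T}$, by cyclic permutation of the coordinates; its generator $\gamma$ is the standard $n$-cycle $\gamma(i)=i+1 \bmod n$. $(k,n)$ denotes the highest common factor of $k$ and $n$. Extended quotient: if a finite abelian group $\Gamma$ acts continuously on a compact Hausdorff space $X$, put $\widetilde X=\{(x,\gamma)\in X\times\Gamma:\gamma x=x\}$ with $\Gamma$-action $g\cdot(x,\gamma)=(gx,\gamma)$; then $X/\!/\Gamma:=\widetilde X/\Gamma=\bigsqcup_{\gamma\in\Gamma}X^\gamma/\Gamma$, where $X^\gamma$ is the $\gamma$-fixed set. For $1\le k\le n$ and $\omega\in\mathbb{C}$ with $\omega^{n/(k,n)}=1$, let $\mathfrak{Y}(n,k,\omega)\subset\mathbb{T}^n/\mathbb{T}$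 be the set of all cosets $t\cdot\mathbb{T}$ where $t=(z_1,\dots,z_n)\in\mathbb{T}^n$ satisfies $z_{i+k}=\omega^{-1}z_i$ for all $i$ (suffices mod $n$). The set $\mathfrak{Y}(n,k,\omega)$ consists of $\gamma^k$-fixed points. Then $\mathfrak{X}(n,k,\omega):=\mathfrak{Y}(n,k,\omega)/(\mathbb{Z}/n\mathbb{Z})$. The equality in the claim is a homeomorphism. *)

theory Defs
  imports "HOL-Analysis.Analysis" "HOL-Algebra.Group_Action" "HOL-Algebra.Elementary_Groups"
begin

section \<open>Quotients and extended quotients\<close>

definition quotient_topology :: "'a topology \<Rightarrow> ('a \<Rightarrow> 'b) \<Rightarrow> 'b topology" where
  "quotient_topology X f =
     topology (\<lambda>V. V \<subseteq> f ` topspace X \<and> openin X {x \<in> topspace X. f x \<in> V})"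

lemma openin_quotient_topology:
  "openin (quotient_topology X f) V \<longleftrightarrow>
     V \<subseteq> f ` topspace X \<and> openin X {x \<in> topspace X. f x \<in> V}"
proof -
  have "istopology (\<lambda>V. V \<subseteq> f ` topspace X \<and> openin X {x \<in> topspace X. f x \<in> V})"
    unfolding istopology_def
  proof (rule conjI; intro allI impI)
    fix S T
    assume *: "S \<subseteq> f ` topspace X \<and> openin X {x \<in> topspace X. f x \<in> S}"
              "T \<subseteq> f ` topspace X \<and> openin X {x \<in> topspace X. f x \<in> T}"
    have "{x \<in> topspace X. f x \<in> S \<inter> T} =
          {x \<in> topspace X. f x \<in> S} \<inter> {x \<in> topspace X. f x \<in> T}" by blast
    then show "S \<inter> T \<subseteq> f ` topspace X \<and> openin X {x \<in> topspace X. f x \<in> S \<inter> T}"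
      using * by auto
  next
    fix \<K>
    assume *: "\<forall>K\<in>\<K>. K \<subseteq> f ` topspace X \<and> openin X {x \<in> topspace X. f x \<in> K}"
    have "{x \<in> topspace X. f x \<in> \<Union>\<K>} = (\<Union>K\<in>\<K>. {x \<in> topspace X. f x \<in> K})" by blast
    then show "\<Union>\<K> \<subseteq> f ` topspace X \<and> openin X {x \<in> topspace X. f x \<in> \<Union>\<K>}"
      using * by auto
  qed
  then show ?thesis
    unfolding quotient_topology_def by (simp add: topology_inverse')
qed

text \<open>Actions are plain functions \<open>\<alpha> :: 'g \<Rightarrow> 'a \<Rightarrow> 'a\<close>; only the values on the group and on the
  space matter. A point of the orbit space is an orbit.\<close>

definition orbit_space :: "'a topology \<Rightarrow> ('g, 'm) monoid_scheme \<Rightarrow> ('g \<Rightarrow> 'a \<Rightarrow> 'a) \<Rightarrow> 'a set topology"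
  where "orbit_space X G \<alpha> = quotient_topology X (orbit G \<alpha>)"

definition ext_space ::
  "'a topology \<Rightarrow> ('g, 'm) monoid_scheme \<Rightarrow> ('g \<Rightarrow> 'a \<Rightarrow> 'a) \<Rightarrow> ('a \<times> 'g) topology" where
  "ext_space X G \<alpha> =
     subtopology (prod_topology X (discrete_topology (carrier G))) {(x, c). \<alpha> c x = x}"

definition ext_quotient ::
  "'a topology \<Rightarrow> ('g, 'm) monoid_scheme \<Rightarrow> ('g \<Rightarrow> 'a \<Rightarrow> 'a) \<Rightarrow> ('a \<times> 'g) set topology" where
  "ext_quotient X G \<alpha> = orbit_space (ext_space X G \<alpha>) G (\<lambda>g (x, c). (\<alpha> g x, c))"


section \<open>The torus modulo the diagonal circle\<close>

text \<open>The \<open>n\<close> coordinates are indexed by the residues \<open>0, \<dots>, n - 1\<close>; points of \<open>torus n\<close> are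
  extensional functions on this index set.\<close>

definition circle_group :: "complex monoid" where
  "circle_group = \<lparr>carrier = {z. norm z = 1}, monoid.mult = (*), one = 1\<rparr>"

definition torus :: "nat \<Rightarrow> (nat \<Rightarrow> complex) topology" where
  "torus n = product_topology (\<lambda>_. top_of_set {z. norm z = 1}) {..<n}"

definition diag_act :: "nat \<Rightarrow> complex \<Rightarrow> (nat \<Rightarrow> complex) \<Rightarrow> nat \<Rightarrow> complex" where
  "diag_act n s t = (\<lambda>i\<in>{..<n}. s * t i)"

abbreviation coset :: "nat \<Rightarrow> (nat \<Rightarrow> complex) \<Rightarrow> (nat \<Rightarrow> complex) set" where
  "coset n t \<equiv> orbit circle_group (diag_act n) t"

definition torus_mod :: "nat \<Rightarrow> (nat \<Rightarrow> complex) set topology" where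
  "torus_mod n = orbit_space (torus n) circle_group (diag_act n)"

text \<open>A permutation \<open>\<sigma>\<close> moves the coordinate \<open>t\<^sub>i\<close> to place \<open>\<sigma> i\<close>. Hence \<open>\<gamma>\<^sup>g t\<close> has \<open>i\<close>-th coordinate
  \<open>t\<^bsub>i-g\<^esub>\<close>, and \<open>\<gamma>\<^sup>k t = \<omega> t\<close> says \<open>t\<^bsub>i+k\<^esub> = \<omega>\<^sup>-\<^sup>1 t\<^sub>i\<close>.\<close>

definition cyc_torus :: "nat \<Rightarrow> int \<Rightarrow> (nat \<Rightarrow> complex) \<Rightarrow> nat \<Rightarrow> complex" where
  "cyc_torus n g t = (\<lambda>i\<in>{..<n}. t (nat ((int i - g) mod int n)))"

definition cyc :: "nat \<Rightarrow> int \<Rightarrow> (nat \<Rightarrow> complex) set \<Rightarrow> (nat \<Rightarrow> complex) set" where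
  "cyc n g C = cyc_torus n g ` C"

definition YY :: "nat \<Rightarrow> nat \<Rightarrow> complex \<Rightarrow> (nat \<Rightarrow> complex) set set" where
  "YY n k \<omega> = {coset n t | t. t \<in> topspace (torus n) \<and>
                              (\<forall>i<n. t ((i + k) mod n) = inverse \<omega> * t i)}"

definition XX :: "nat \<Rightarrow> nat \<Rightarrow> complex \<Rightarrow> (nat \<Rightarrow> complex) set set topology" where
  "XX n k \<omega> = orbit_space (subtopology (torus_mod n) (YY n k \<omega>)) (integer_mod_group n) (cyc n)"

definition XX_index :: "nat \<Rightarrow> (nat \<times> complex) set" where
  "XX_index n = {(k, \<omega>). 1 \<le> k \<and> k \<le> n \<and> \<omega> ^ (n div gcd k n) = 1}"


section \<open>Smooth maps between open subsets of Euclidean spaces\<close>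

text \<open>Since the dimension of an orbifold is a number, \<open>\<real>\<^sup>m\<close> is the library's \<open>Euclidean_space m\<close>,
  whose points are the sequences vanishing from index \<open>m\<close> on. \<open>Ck_on\<close> says that the iterated
  partial derivatives up to the given order exist and are continuous.\<close>

fun Ck_on :: "nat \<Rightarrow> nat \<Rightarrow> (nat \<Rightarrow> real) set \<Rightarrow> ((nat \<Rightarrow> real) \<Rightarrow> real) \<Rightarrow> bool" where
  "Ck_on m 0 U f \<longleftrightarrow> continuous_map (subtopology (Euclidean_space m) U) euclideanreal f"
| "Ck_on m (Suc r) U f \<longleftrightarrow>
     continuous_map (subtopology (Euclidean_space m) U) euclideanreal f \<and>
     (\<exists>f'. \<forall>j<m. (\<forall>x\<in>U. ((\<lambda>s. f (x(j := s))) has_real_derivative f' j x) (at (x j)))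
                 \<and> Ck_on m r U (f' j))"

definition smooth_fun_on :: "nat \<Rightarrow> (nat \<Rightarrow> real) set \<Rightarrow> ((nat \<Rightarrow> real) \<Rightarrow> real) \<Rightarrow> bool" where
  "smooth_fun_on m U f \<longleftrightarrow> (\<forall>r. Ck_on m r U f)"

definition smooth_map_on ::
  "nat \<Rightarrow> (nat \<Rightarrow> real) set \<Rightarrow> (nat \<Rightarrow> real) set \<Rightarrow> ((nat \<Rightarrow> real) \<Rightarrow> nat \<Rightarrow> real) \<Rightarrow> bool" where
  "smooth_map_on m U V f \<longleftrightarrow> f \<in> U \<rightarrow> V \<and> (\<forall>j<m. smooth_fun_on m U (\<lambda>x. f x j))"

text \<open>Source and target have the same dimension, so a smooth embedding is a diffeomorphism onto an
  open subset.\<close>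

definition smooth_open_embedding ::
  "nat \<Rightarrow> (nat \<Rightarrow> real) set \<Rightarrow> (nat \<Rightarrow> real) set \<Rightarrow> ((nat \<Rightarrow> real) \<Rightarrow> nat \<Rightarrow> real) \<Rightarrow> bool" where
  "smooth_open_embedding m U V f \<longleftrightarrow>
     smooth_map_on m U V f \<and> inj_on f U \<and> openin (Euclidean_space m) (f ` U) \<and>
     smooth_map_on m (f ` U) U (inv_into U f)"


section \<open>Orbifolds\<close>

text \<open>Smooth effective orbifolds in the sense of Satake. A chart is a triple \<open>(U, G, \<phi>)\<close>: a connected
  open \<open>U \<subseteq> \<real>\<^sup>m\<close>, a finite group \<open>G\<close> of diffeomorphisms of \<open>U\<close>, and a map \<open>\<phi>\<close> from \<open>U\<close> to the space
  which induces a homeomorphism of \<open>U/G\<close> onto an open subset, i.e. which is an identification map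
  onto its open image with the \<open>G\<close>-orbits as its fibres.\<close>

type_synonym 'a orbifold_chart =
  "(nat \<Rightarrow> real) set \<times> ((nat \<Rightarrow> real) \<Rightarrow> nat \<Rightarrow> real) set \<times> ((nat \<Rightarrow> real) \<Rightarrow> 'a)"

definition orbifold_chart :: "'a topology \<Rightarrow> nat \<Rightarrow> 'a orbifold_chart \<Rightarrow> bool" where
  "orbifold_chart X m = (\<lambda>(U, G, \<phi>).
     openin (Euclidean_space m) U \<and> U \<noteq> {} \<and> connectedin (Euclidean_space m) U \<and>
     finite G \<and> subgroup G (BijGroup U) \<and> (\<forall>g\<in>G. smooth_map_on m U U g) \<and>
     openin X (\<phi> ` U) \<and>
     quotient_map (subtopology (Euclidean_space m) U) (subtopology X (\<phi> ` U)) \<phi> \<and>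
     (\<forall>x\<in>U. \<forall>y\<in>U. \<phi> x = \<phi> y \<longleftrightarrow> (\<exists>g\<in>G. y = g x)))"

definition chart_embedding ::
  "nat \<Rightarrow> 'a orbifold_chart \<Rightarrow> 'a orbifold_chart \<Rightarrow> ((nat \<Rightarrow> real) \<Rightarrow> nat \<Rightarrow> real) \<Rightarrow> bool" where
  "chart_embedding m = (\<lambda>(U, G, \<phi>) (V, H, \<psi>) f.
     smooth_open_embedding m U V f \<and> (\<forall>x\<in>U. \<psi> (f x) = \<phi> x))"

definition orbifold_atlas :: "'a topology \<Rightarrow> nat \<Rightarrow> 'a orbifold_chart set \<Rightarrow> bool" where
  "orbifold_atlas X m A \<longleftrightarrow>
     (\<forall>c\<in>A. orbifold_chart X m c) \<and>
     (\<Union>(U, G, \<phi>)\<in>A. \<phi> ` U) = topspace X \<and>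
     (\<forall>(U, G, \<phi>)\<in>A. \<forall>(V, H, \<psi>)\<in>A. \<forall>p\<in>\<phi> ` U \<inter> \<psi> ` V.
        \<exists>W K \<mu> f g. orbifold_chart X m (W, K, \<mu>) \<and> p \<in> \<mu> ` W \<and> \<mu> ` W \<subseteq> \<phi> ` U \<inter> \<psi> ` V \<and>
          chart_embedding m (W, K, \<mu>) (U, G, \<phi>) f \<and>
          chart_embedding m (W, K, \<mu>) (V, H, \<psi>) g)"

definition paracompact_space :: "'a topology \<Rightarrow> bool" where
  "paracompact_space X \<longleftrightarrow>
     (\<forall>\<U>. (\<forall>U\<in>\<U>. openin X U) \<and> \<Union>\<U> = topspace X \<longrightarrow>
        (\<exists>\<V>. (\<forall>V\<in>\<V>. openin X V) \<and> \<Union>\<V> = topspace X \<and>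
             (\<forall>V\<in>\<V>. \<exists>U\<in>\<U>. V \<subseteq> U) \<and> locally_finite_in X \<V>))"

definition orbifold :: "'a topology \<Rightarrow> nat \<Rightarrow> 'a orbifold_chart set \<Rightarrow> bool" where
  "orbifold X m A \<longleftrightarrow> Hausdorff_space X \<and> paracompact_space X \<and> orbifold_atlas X m A"

text \<open>Smooth local parametrizations of a submanifold \<open>Y\<close> of \<open>\<T>\<^sup>n/\<T>\<close>: homeomorphisms from \<open>U \<subseteq> \<real>\<^sup>m\<close>
  onto an open subset of \<open>Y\<close>, of the form \<open>x \<mapsto> (e\<^bsup>i\<theta>\<^sub>0(x)\<^esup>, \<dots>, e\<^bsup>i\<theta>\<^sub>n\<^sub>-\<^sub>1(x)\<^esup>)\<T>\<close> with
  \<open>\<theta>\<close> smooth. The last clause says that this is an immersion: the tangent space of \<open>\<T>\<^sup>n/\<T>\<close> is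
  \<open>\<real>\<^sup>n/\<real>(1,\<dots>,1)\<close>, so the derivative of \<open>\<theta>\<close> along a nonzero vector must not be a constant vector.\<close>

definition smooth_param ::
  "nat \<Rightarrow> (nat \<Rightarrow> complex) set set \<Rightarrow> nat \<Rightarrow> (nat \<Rightarrow> real) set
     \<Rightarrow> ((nat \<Rightarrow> real) \<Rightarrow> (nat \<Rightarrow> complex) set) \<Rightarrow> bool" where
  "smooth_param n Y m U \<psi> \<longleftrightarrow>
     openin (subtopology (torus_mod n) Y) (\<psi> ` U) \<and>
     homeomorphic_map (subtopology (Euclidean_space m) U) (subtopology (torus_mod n) (\<psi> ` U)) \<psi> \<and>
     (\<exists>\<theta>. (\<forall>i<n. smooth_fun_on m U (\<lambda>x. \<theta> x i)) \<and>
          (\<forall>x\<in>U. \<psi> x = coset n (\<lambda>i\<in>{..<n}. cis (\<theta> x i))) \<and>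
          (\<forall>x\<in>U. \<forall>v\<in>topspace (Euclidean_space m).
             (\<forall>i<n. ((\<lambda>s. \<theta> (\<lambda>j. x j + s * v j) i - \<theta> (\<lambda>j. x j + s * v j) 0)
                       has_real_derivative 0) (at 0))
             \<longrightarrow> v = (\<lambda>_. 0)))"

text \<open>The orbifold structure of a quotient \<open>Y/(\<int>/n\<int>)\<close> is the one coming from the smooth structure
  of \<open>Y\<close>: its charts are smooth parametrizations of \<open>Y\<close> followed by the projection.\<close>

definition charts_from_cover ::
  "nat \<Rightarrow> (nat \<Rightarrow> complex) set set \<Rightarrow> nat \<Rightarrow> (nat \<Rightarrow> complex) set set orbifold_chart set \<Rightarrow> bool" where
  "charts_from_cover n Y m A \<longleftrightarrow>
     (\<forall>(U, G, \<phi>)\<in>A. \<exists>\<psi>. smooth_param n Y m U \<psi> \<and>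
        (\<forall>x\<in>U. \<phi> x = orbit (integer_mod_group n) (cyc n) (\<psi> x)))"

end

theory Submission
  imports Defs
begin

text \<open>Let \<open>d = gcd k n\<close>. For \<open>t \<in> \<T>\<^sup>n\<close> with \<open>t\<^bsub>i+k\<^esub> = \<omega>\<^sup>-\<^sup>1 t\<^sub>i\<close>, the quotient of any other solution by \<open>t\<close> is invariant
  under shifts by \<open>k\<close>, hence depends only on \<open>i mod d\<close>. So \<open>x \<mapsto> (t\<^sub>i exp (\<i> x\<^bsub>i mod d\<^esub>))\<^sub>i \<T>\<close> maps
  \<open>\<real>\<^sup>d/\<real>(1,\<dots>,1)\<close> onto \<open>YY n k \<omega>\<close>, it is injective on the vectors whose coordinate differences are less
  than \<open>\<pi>\<close>, and the cyclic group acts through the linear cyclic shift of \<open>\<real>\<^sup>d\<close>. The shift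
  preserves the boxes given by bounding all coordinate differences, so small boxes with
  the stabilizer of the coset of \<open>t\<close> are orbifold charts, and translations composed with shifts are
  the embeddings between them. A coset fixed by \<open>\<gamma>\<^sup>k\<close> determines the scalar \<open>\<omega>\<close> with
  \<open>\<gamma>\<^sup>k t = \<omega> t\<close>; this makes the map from the disjoint union a continuous bijection from a
  compact space to a Hausdorff space.\<close>

section \<open>Orbit spaces\<close>

text \<open>The existence of a solution \<open>t\<close> is arithmetic: one needs an n/d-th root of
  unity \<eta> with \<eta>^(k/d) = 1/\<omega>, and k/d is a unit modulo n/d. All parametrizations
  are one map with varying base point, so chart groups and transition maps are affine in the
  exponents. The calculus therefore reduces to affine functions. The bound \<pi> comes from the
  branch cut of \<open>Arg\<close>, which recovers exponents from ratios of coordinates. A box may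
  have to be smaller still: a rotation that does not fix the coset of \<open>t\<close> must move the
  box off itself. One of the \<open>d\<close> exponents is absorbed by the diagonal circle, so the
  dimension is d - 1 and exponents are normalised by making the last one zero. Different rotations
  in a stabilizer can induce the same shift. The chart groups are therefore sets of maps, which
  makes them effective. The circle is infinite, so the argument that separates orbits of a finite
  group cannot be used for \<open>torus_mod n\<close>; ratios of coordinates separate its points and
  also invert the charts.\<close>

lemma topspace_quotient_topology [simp]:
  "topspace (quotient_topology X f) = f ` topspace X"
proof -
  have "openin (quotient_topology X f) (f ` topspace X)"
  proof -
    have "{x \<in> topspace X. f x \<in> f ` topspace X} = topspace X" by blast
    then show ?thesis by (simp add: openin_quotient_topology)
  qed
  then show ?thesis
    using openin_topspace[of "quotient_topology X f"]
    unfolding openin_quotient_topology[of X f "topspace _"] by (simp add: openin_subset subset_antisym)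
qed

lemma quotient_map_quotient_topology: "quotient_map X (quotient_topology X f) f"
  by (auto simp: quotient_map_def openin_quotient_topology)

lemma topspace_orbit_space [simp]: "topspace (orbit_space X G \<alpha>) = orbit G \<alpha> ` topspace X"
  by (simp add: orbit_space_def)

lemma quotient_map_orbit: "quotient_map X (orbit_space X G \<alpha>) (orbit G \<alpha>)"
  by (simp add: orbit_space_def quotient_map_quotient_topology)

lemma continuous_map_orbit: "continuous_map X (orbit_space X G \<alpha>) (orbit G \<alpha>)"
  by (simp add: quotient_map_orbit quotient_imp_continuous_map)

text \<open>The laws are asked for only on \<open>topspace X\<close>: the actions used here are
  total functions, and off the space even the unit may move a point, since \<open>diag_act\<close>
  and \<open>cyc_torus\<close> return extensional functions.\<close>

locale continuous_action = group G for X :: "'a topology" and G (structure) and \<alpha> :: "'g \<Rightarrow> 'a \<Rightarrow> 'a" +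
  assumes continuous: "g \<in> carrier G \<Longrightarrow> continuous_map X X (\<alpha> g)"
    and act_one: "x \<in> topspace X \<Longrightarrow> \<alpha> \<one> x = x"
    and act_mult: "\<lbrakk>g \<in> carrier G; h \<in> carrier G; x \<in> topspace X\<rbrakk> \<Longrightarrow> \<alpha> (g \<otimes> h) x = \<alpha> g (\<alpha> h x)"
begin

lemma act_closed: "\<lbrakk>g \<in> carrier G; x \<in> topspace X\<rbrakk> \<Longrightarrow> \<alpha> g x \<in> topspace X"
  using continuous continuous_map_image_subset_topspace by fastforce

lemma act_inv: "\<lbrakk>g \<in> carrier G; x \<in> topspace X\<rbrakk> \<Longrightarrow> \<alpha> (inv g) (\<alpha> g x) = x"
  by (metis act_mult act_one inv_closed l_inv)

lemma orbit_self: "x \<in> topspace X \<Longrightarrow> x \<in> orbit G \<alpha> x"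
  unfolding orbit_def using act_one one_closed by force

lemma orbit_subset: "x \<in> topspace X \<Longrightarrow> orbit G \<alpha> x \<subseteq> topspace X"
  unfolding orbit_def using act_closed by blast

lemma orbit_act:
  assumes "g \<in> carrier G" "x \<in> topspace X"
  shows "orbit G \<alpha> (\<alpha> g x) = orbit G \<alpha> x"
proof -
  have "\<alpha> h x = \<alpha> (h \<otimes> inv g) (\<alpha> g x)" if "h \<in> carrier G" for h
    using that assms by (metis act_closed act_inv act_mult inv_closed)
  moreover have "\<alpha> h (\<alpha> g x) = \<alpha> (h \<otimes> g) x" if "h \<in> carrier G" for h
    using that assms by (metis act_mult)
  ultimately show ?thesis
    unfolding orbit_def using assms(1) by (smt (verit) Collect_cong inv_closed m_closed)
qed

lemma orbit_eq_iff:
  assumes "x \<in> topspace X" "y \<in> topspace X"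
  shows "orbit G \<alpha> x = orbit G \<alpha> y \<longleftrightarrow> (\<exists>g\<in>carrier G. y = \<alpha> g x)"
proof
  assume "orbit G \<alpha> x = orbit G \<alpha> y"
  then have "y \<in> orbit G \<alpha> x" using orbit_self assms by simp
  then show "\<exists>g\<in>carrier G. y = \<alpha> g x" by (auto simp: orbit_def)
qed (use assms orbit_act in auto)

lemma orbit_eq_if_mem: "\<lbrakk>x \<in> topspace X; y \<in> orbit G \<alpha> x\<rbrakk> \<Longrightarrow> orbit G \<alpha> y = orbit G \<alpha> x"
  using orbit_act[of _ x] by (auto simp: orbit_def[of _ _ x])

text \<open>The saturation of an open set is the union of its preimages under the single group
  elements, each of them open.\<close>

lemma open_map_orbit: "open_map X (orbit_space X G \<alpha>) (orbit G \<alpha>)"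
  unfolding open_map_def
proof (intro allI impI)
  fix U assume U: "openin X U"
  have sub: "U \<subseteq> topspace X" using U by (rule openin_subset)
  have "{x \<in> topspace X. orbit G \<alpha> x \<in> orbit G \<alpha> ` U} =
        (\<Union>g\<in>carrier G. {x \<in> topspace X. \<alpha> g x \<in> U})"
  proof (intro equalityI subsetI)
    fix x assume "x \<in> {x \<in> topspace X. orbit G \<alpha> x \<in> orbit G \<alpha> ` U}"
    then obtain u where "x \<in> topspace X" "u \<in> U" "orbit G \<alpha> x = orbit G \<alpha> u" by auto
    then show "x \<in> (\<Union>g\<in>carrier G. {x \<in> topspace X. \<alpha> g x \<in> U})"
      using orbit_eq_iff[of x u] sub by auto
  next
    fix x assume "x \<in> (\<Union>g\<in>carrier G. {x \<in> topspace X. \<alpha> g x \<in> U})"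
    then obtain g where "g \<in> carrier G" "x \<in> topspace X" "\<alpha> g x \<in> U" by auto
    then show "x \<in> {x \<in> topspace X. orbit G \<alpha> x \<in> orbit G \<alpha> ` U}"
      using orbit_act[of g x] by (metis (mono_tags, lifting) imageI mem_Collect_eq)
  qed
  moreover have "openin X (\<Union>g\<in>carrier G. {x \<in> topspace X. \<alpha> g x \<in> U})"
    using continuous U by (intro openin_Union) (auto intro: openin_continuous_map_preimage)
  ultimately show "openin (orbit_space X G \<alpha>) (orbit G \<alpha> ` U)"
    unfolding orbit_space_def openin_quotient_topology using sub by auto
qed

text \<open>Distinct orbits are disjoint finite sets, so a Hausdorff space separates them as compact
  sets. The separating open sets are then shrunk to invariant ones, whose images stay
  disjoint.\<close>

lemma Hausdorff_orbit_space:
  assumes fin: "finite (carrier G)" and X: "Hausdorff_space X"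
  shows "Hausdorff_space (orbit_space X G \<alpha>)"
  unfolding Hausdorff_space_def
proof (intro allI impI)
  fix P Q assume PQ: "P \<in> topspace (orbit_space X G \<alpha>) \<and> Q \<in> topspace (orbit_space X G \<alpha>) \<and> P \<noteq> Q"
  then obtain x y where xy: "x \<in> topspace X" "y \<in> topspace X" "P = orbit G \<alpha> x" "Q = orbit G \<alpha> y"
    by auto
  have fin_orbit: "finite (orbit G \<alpha> z)" for z
    unfolding orbit_def using fin by (simp add: setcompr_eq_image)
  have "disjnt P Q"
    using PQ orbit_eq_if_mem[OF xy(1)] orbit_eq_if_mem[OF xy(2)] unfolding disjnt_iff xy(3,4) by metis
  moreover have "compactin X P" "compactin X Q"
    using xy fin_orbit orbit_subset by (auto intro: finite_imp_compactin)
  ultimately obtain U V where UV: "openin X U" "openin X V" "P \<subseteq> U" "Q \<subseteq> V" "disjnt U V"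
    using X unfolding Hausdorff_space_compact_sets by metis
  \<comment> \<open>The points whose whole orbit lies in \<open>W\<close>. This invariant part of
    \<open>W\<close> is open because it is a finite intersection of preimages.\<close>
  define core where "core W = topspace X \<inter> (\<Inter>g\<in>carrier G. {z \<in> topspace X. \<alpha> g z \<in> W})" for W
  have op: "openin X (core W)" if "openin X W" for W
    unfolding core_def using that fin continuous
    by (intro openin_Int openin_topspace openin_Inter) (auto intro: openin_continuous_map_preimage)
  have inU: "z \<in> core W" if "z \<in> topspace X" "orbit G \<alpha> z \<subseteq> W" for z W
    using that unfolding core_def orbit_def by auto
  have "disjnt (orbit G \<alpha> ` core U) (orbit G \<alpha> ` core V)"
    unfolding disjnt_iff
  proof clarify
    fix u v assume uv: "u \<in> core U" "v \<in> core V" "orbit G \<alpha> u = orbit G \<alpha> v"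
    then have tops: "u \<in> topspace X" "v \<in> topspace X" by (auto simp: core_def)
    obtain g where "g \<in> carrier G" "v = \<alpha> g u" using orbit_eq_iff tops uv(3) by auto
    then have "v \<in> U" using uv(1) by (auto simp: core_def)
    moreover have "v \<in> V"
      using uv(2) act_one[OF tops(2)] unfolding core_def by force
    ultimately show False using UV(5) by (auto simp: disjnt_iff)
  qed
  moreover have "openin (orbit_space X G \<alpha>) (orbit G \<alpha> ` core U)"
       "openin (orbit_space X G \<alpha>) (orbit G \<alpha> ` core V)"
    using open_map_orbit op UV(1,2) by (auto simp: open_map_def)
  ultimately show "\<exists>U V. openin (orbit_space X G \<alpha>) U \<and> openin (orbit_space X G \<alpha>) V \<and>
      P \<in> U \<and> Q \<in> V \<and> disjnt U V"
    using inU[OF xy(1), of U] inU[OF xy(2), of V] UV(3,4) unfolding xy(3,4) by blast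
qed

lemma restrict_invariant:
  assumes "\<And>g x. \<lbrakk>g \<in> carrier G; x \<in> topspace X; x \<in> Y\<rbrakk> \<Longrightarrow> \<alpha> g x \<in> Y"
  shows "continuous_action (subtopology X Y) G \<alpha>"
proof
  fix g assume "g \<in> carrier G"
  then show "continuous_map (subtopology X Y) (subtopology X Y) (\<alpha> g)"
    using assms continuous by (auto simp: continuous_map_in_subtopology continuous_map_from_subtopology)
qed (auto simp: act_one act_mult)

text \<open>In general \<open>g\<close> carries the fixed points of \<open>c\<close> to those of its
  conjugate by \<open>g\<close>; commutativity makes the conjugate equal to \<open>c\<close>, so the
  second component can stay put.\<close>

lemma ext_space_action:
  assumes comm: "\<And>g h. \<lbrakk>g \<in> carrier G; h \<in> carrier G\<rbrakk> \<Longrightarrow> g \<otimes> h = h \<otimes> g"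
  shows "continuous_action (ext_space X G \<alpha>) G (\<lambda>g (x, c). (\<alpha> g x, c))"
proof -
  let ?P = "prod_topology X (discrete_topology (carrier G))"
  interpret P: continuous_action ?P G "\<lambda>g (x, c). (\<alpha> g x, c)"
  proof
    fix g assume g: "g \<in> carrier G"
    have "continuous_map ?P ?P (\<lambda>p. (\<alpha> g (fst p), snd p))"
      using continuous_map_compose[OF continuous_map_fst continuous[OF g]]
      by (intro continuous_map_pairedI) (simp_all add: o_def continuous_map_snd)
    then show "continuous_map ?P ?P (\<lambda>(x, c). (\<alpha> g x, c))" by (simp add: case_prod_unfold)
  qed (auto simp: act_one act_mult)
  show ?thesis
    unfolding ext_space_def
  proof (rule P.restrict_invariant)
    fix g p assume *: "g \<in> carrier G" "p \<in> topspace ?P" "p \<in> {(x, c). \<alpha> c x = x}"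
    then obtain x c where p: "p = (x, c)" "x \<in> topspace X" "c \<in> carrier G" "\<alpha> c x = x" by auto
    then have "\<alpha> c (\<alpha> g x) = \<alpha> g x" 
      using act_mult[of c g x] act_mult[of g c x] comm[of c g] *(1) by simp
    then show "(case p of (x, c) \<Rightarrow> (\<alpha> g x, c)) \<in> {(x, c). \<alpha> c x = x}" using p by simp
  qed
qed

end

section \<open>Tools on separation, continuity and compactness\<close>

lemma Hausdorff_space_separating:
  assumes "\<And>x y. \<lbrakk>x \<in> topspace X; y \<in> topspace X; x \<noteq> y\<rbrakk> \<Longrightarrow>
     \<exists>f. continuous_map X (euclidean :: 'b::t2_space topology) f \<and> f x \<noteq> f y"
  shows "Hausdorff_space X"
  unfolding Hausdorff_space_def
proof (intro allI impI)
  fix x y assume xy: "x \<in> topspace X \<and> y \<in> topspace X \<and> x \<noteq> y"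
  then obtain f :: "'a \<Rightarrow> 'b" where f: "continuous_map X euclidean f" "f x \<noteq> f y" using assms by blast
  obtain A B where "open A" "open B" "f x \<in> A" "f y \<in> B" "A \<inter> B = {}" using hausdorff[OF f(2)] by auto
  then show "\<exists>U V. openin X U \<and> openin X V \<and> x \<in> U \<and> y \<in> V \<and> disjnt U V"
    using xy openin_continuous_map_preimage[OF f(1)]
    by (intro exI[of _ "{z \<in> topspace X. f z \<in> A}"] exI[of _ "{z \<in> topspace X. f z \<in> B}"])
       (auto simp: disjnt_iff)
qed

lemma continuous_map_mult:
  fixes f g :: "'a \<Rightarrow> 'b::real_normed_algebra"
  shows "\<lbrakk>continuous_map X euclidean f; continuous_map X euclidean g\<rbrakk>
    \<Longrightarrow> continuous_map X euclidean (\<lambda>x. f x * g x)"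
  by (simp add: continuous_map_atin tendsto_mult)

lemma continuous_map_divide:
  fixes f g :: "'a \<Rightarrow> 'b::real_normed_field"
  shows "\<lbrakk>continuous_map X euclidean f; continuous_map X euclidean g; \<And>x. x \<in> topspace X \<Longrightarrow> g x \<noteq> 0\<rbrakk>
    \<Longrightarrow> continuous_map X euclidean (\<lambda>x. f x / g x)"
  by (simp add: continuous_map_atin tendsto_divide)

text \<open>Meant for functions such as \<open>Arg\<close> that are continuous only on a part
  \<open>S\<close> of the plane.\<close>

lemma continuous_map_continuous_on_compose:
  assumes "continuous_map X euclidean f" "continuous_on S h" "f \<in> topspace X \<rightarrow> S"
  shows "continuous_map X euclidean (\<lambda>x. h (f x))"
proof -
  have "continuous_map X (top_of_set S) f"
    using assms(1,3) by (simp add: continuous_map_into_subtopology)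
  moreover have "continuous_map (top_of_set S) euclidean h"
    using assms(2) by simp
  ultimately have "continuous_map X euclidean (h \<circ> f)" by (rule continuous_map_compose)
  then show ?thesis by (simp add: o_def)
qed

lemma compact_imp_paracompact_space:
  assumes "compact_space X" shows "paracompact_space X"
  unfolding paracompact_space_def
proof (intro allI impI)
  fix \<U> assume U: "(\<forall>U\<in>\<U>. openin X U) \<and> \<Union>\<U> = topspace X"
  then obtain \<F> where "finite \<F>" "\<F> \<subseteq> \<U>" "topspace X \<subseteq> \<Union>\<F>"
    using assms unfolding compact_space_alt by (metis order_refl)
  note F = this
  have eq: "\<Union>\<F> = topspace X" using Union_mono[OF F(2)] F(3) U by (simp add: subset_antisym)
  have "locally_finite_in X \<F>"
    unfolding locally_finite_in_def
    using F(1) eq by (auto intro!: exI[of _ "topspace X"])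
  moreover have "\<forall>V\<in>\<F>. openin X V" using U F(2) by blast
  moreover have "\<forall>V\<in>\<F>. \<exists>U\<in>\<U>. V \<subseteq> U" using F(2) by blast
  ultimately show "\<exists>\<V>. (\<forall>V\<in>\<V>. openin X V) \<and> \<Union>\<V> = topspace X \<and>
             (\<forall>V\<in>\<V>. \<exists>U\<in>\<U>. V \<subseteq> U) \<and> locally_finite_in X \<V>"
    using eq by blast
qed

lemma compact_space_sum_topology:
  assumes "finite I" "\<And>i. i \<in> I \<Longrightarrow> compact_space (X i)"
  shows "compact_space (sum_topology X I)"
proof -
  have "compactin (sum_topology X I) (\<Union>i\<in>I. Pair i ` topspace (X i))"
  proof (rule compactin_Union)
    fix C assume "C \<in> (\<lambda>i. Pair i ` topspace (X i)) ` I"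
    then obtain i where "i \<in> I" "C = Pair i ` topspace (X i)" by auto
    then show "compactin (sum_topology X I) C"
      using assms(2) continuous_map_component_injection[of i I X]
      by (auto intro!: image_compactin simp: compact_space_def)
  qed (use assms in auto)
  moreover have "(\<Union>i\<in>I. Pair i ` topspace (X i)) = topspace (sum_topology X I)" by auto
  ultimately show ?thesis by (simp add: compact_space_def)
qed

section \<open>The torus and its quotient by the circle\<close>

text \<open>The place from which \<open>cyc_torus n g\<close> reads its \<open>i\<close>-th
  coordinate. Naming it turns laws of the action into arithmetic of residues.\<close>

definition rot :: "nat \<Rightarrow> int \<Rightarrow> nat \<Rightarrow> nat" where
  "rot n g i = nat ((int i - g) mod int n)"

lemma rot_less: "n > 0 \<Longrightarrow> rot n g i < n"
  by (simp add: rot_def nat_less_iff)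

lemma int_rot: "n > 0 \<Longrightarrow> int (rot n g i) = (int i - g) mod int n"
  by (simp add: rot_def)

lemma rot_rot: "n > 0 \<Longrightarrow> rot n h (rot n g i) = rot n (g + h) i"
  by (simp add: rot_def mod_simps algebra_simps)

lemma rot_0: "i < n \<Longrightarrow> rot n 0 i = i"
  by (simp add: rot_def)

lemma rot_mod: "rot n (g mod int n) i = rot n g i"
  by (simp add: rot_def mod_simps)

lemma rot_uminus_nat: "n > 0 \<Longrightarrow> rot n (- int k) i = (i + k) mod n"
  by (simp add: rot_def nat_mod_as_int)

text \<open>Reduction from residues modulo \<open>n\<close> to residues modulo a divisor
  \<open>d\<close> intertwines the rotations. This is how the group of order \<open>n\<close> comes
  to act on \<open>d\<close> exponents.\<close>

lemma rot_mod_dvd: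
  assumes "n > 0" "d dvd n"
  shows "rot n g i mod d = rot d g (i mod d)"
proof -
  have "d > 0" using assms by (auto intro: Nat.gr0I)
  then have "int (rot n g i mod d) = int (rot d g (i mod d))"
    using assms by (simp add: int_rot zmod_int mod_simps mod_mod_cancel)
  then show ?thesis by simp
qed

lemma cyc_torus_apply: "i < n \<Longrightarrow> cyc_torus n g t i = t (rot n g i)"
  by (simp add: cyc_torus_def rot_def)

lemma cyc_torus_add: "n > 0 \<Longrightarrow> cyc_torus n g (cyc_torus n h t) = cyc_torus n (g + h) t"
  by (rule ext) (simp add: cyc_torus_def rot_def[symmetric] rot_less rot_rot)

lemma cyc_torus_mod: "cyc_torus n (g mod int n) t = cyc_torus n g t"
  by (rule ext) (simp add: cyc_torus_def mod_simps)

lemma topspace_torus: "topspace (torus n) = PiE {..<n} (\<lambda>_. {z. norm z = 1})"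
  by (simp add: torus_def)

lemma torus_norm: "\<lbrakk>t \<in> topspace (torus n); i < n\<rbrakk> \<Longrightarrow> norm (t i) = 1"
  by (auto simp: topspace_torus PiE_iff)

lemma torus_nonzero: "\<lbrakk>t \<in> topspace (torus n); i < n\<rbrakk> \<Longrightarrow> t i \<noteq> 0"
  using torus_norm by fastforce

lemma torus_eqI:
  "\<lbrakk>s \<in> topspace (torus n); t \<in> topspace (torus n); \<And>i. i < n \<Longrightarrow> s i = t i\<rbrakk> \<Longrightarrow> s = t"
  unfolding topspace_torus by (rule PiE_ext) auto

lemma cyc_torus_0: "t \<in> topspace (torus n) \<Longrightarrow> cyc_torus n 0 t = t"
  by (rule ext) (auto simp: cyc_torus_def topspace_torus PiE_iff extensional_def)

lemma compact_torus: "compact_space (torus n)"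
proof -
  have "compact {z::complex. norm z = 1}"
    using compact_sphere[of "0::complex" 1] by (simp add: sphere_def)
  then show ?thesis
    unfolding torus_def by (simp add: compact_space_product_topology compact_space_subtopology compactin_euclidean_iff)
qed

lemma continuous_map_torus_coordinate:
  "i < n \<Longrightarrow> continuous_map (torus n) euclidean (\<lambda>t. t i)"
  unfolding torus_def
  by (metis continuous_map_into_fulltopology continuous_map_product_projection lessThan_iff)

lemma continuous_map_into_torus:
  "continuous_map X (torus n) (\<lambda>x. \<lambda>i\<in>{..<n}. f x i) \<longleftrightarrow>
     (\<forall>i<n. continuous_map X euclidean (\<lambda>x. f x i) \<and> (\<forall>x\<in>topspace X. norm (f x i) = 1))"
  unfolding torus_def
  by (auto simp: continuous_map_componentwise continuous_map_in_subtopology Pi_iff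
      elim: continuous_map_eq)

section \<open>The circle group and its diagonal action\<close>

lemma carrier_circle_group [simp]: "carrier circle_group = {z. norm z = 1}"
  and mult_circle_group [simp]: "x \<otimes>\<^bsub>circle_group\<^esub> y = x * y"
  and one_circle_group [simp]: "\<one>\<^bsub>circle_group\<^esub> = 1"
  by (simp_all add: circle_group_def)

lemma group_circle_group: "group circle_group"
proof (rule groupI)
  fix x assume "x \<in> carrier circle_group"
  then show "\<exists>y\<in>carrier circle_group. y \<otimes>\<^bsub>circle_group\<^esub> x = \<one>\<^bsub>circle_group\<^esub>"
    by (intro bexI[of _ "inverse x"]) (auto simp: norm_inverse intro: left_inverse)
qed (auto simp: norm_mult)

lemma diag_act_apply: "i < n \<Longrightarrow> diag_act n s t i = s * t i"
  by (simp add: diag_act_def)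

lemma diag_action: "continuous_action (torus n) circle_group (diag_act n)"
proof (intro continuous_action.intro group_circle_group continuous_action_axioms.intro)
  fix g assume "g \<in> carrier circle_group"
  then show "continuous_map (torus n) (torus n) (diag_act n g)"
    unfolding diag_act_def continuous_map_into_torus
    by (auto simp: norm_mult torus_norm intro!: continuous_map_mult continuous_map_torus_coordinate)
next
  fix x assume "x \<in> topspace (torus n)"
  then show "diag_act n \<one>\<^bsub>circle_group\<^esub> x = x"
    by (auto simp: diag_act_def topspace_torus PiE_iff extensional_def fun_eq_iff)
qed (auto simp: diag_act_def fun_eq_iff)

interpretation diag: continuous_action "torus n" circle_group "diag_act n" for n
  by (rule diag_action)

lemma coset_conv: "coset n t = {diag_act n s t | s. norm s = 1}"
  by (simp add: orbit_def)

lemma coset_eq_iff: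
  "\<lbrakk>s \<in> topspace (torus n); t \<in> topspace (torus n)\<rbrakk> \<Longrightarrow>
    coset n s = coset n t \<longleftrightarrow> (\<exists>c. norm c = 1 \<and> s = diag_act n c t)"
  using diag.orbit_eq_iff[of t n s] by auto

lemma coset_diag_act:
  "\<lbrakk>norm c = 1; t \<in> topspace (torus n)\<rbrakk> \<Longrightarrow> coset n (diag_act n c t) = coset n t"
  by (rule diag.orbit_act) auto

lemma topspace_torus_mod: "topspace (torus_mod n) = coset n ` topspace (torus n)"
  by (simp add: torus_mod_def)

lemma continuous_map_coset: "continuous_map (torus n) (torus_mod n) (coset n)"
  by (simp add: torus_mod_def continuous_map_orbit)

section \<open>The cyclic action on the torus and on cosets\<close>

lemma cyc_torus_in: "\<lbrakk>n > 0; t \<in> topspace (torus n)\<rbrakk> \<Longrightarrow> cyc_torus n g t \<in> topspace (torus n)"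
  using rot_less by (fastforce simp: cyc_torus_def topspace_torus PiE_iff rot_def[symmetric])

lemma continuous_map_cyc_torus: "n > 0 \<Longrightarrow> continuous_map (torus n) (torus n) (cyc_torus n g)"
  unfolding cyc_torus_def continuous_map_into_torus rot_def[symmetric]
  by (auto simp: torus_norm rot_less intro!: continuous_map_torus_coordinate)

text \<open>Permuting coordinates commutes with multiplication by a scalar.\<close>

lemma cyc_coset:
  assumes "n > 0" shows "cyc n g (coset n t) = coset n (cyc_torus n g t)"
proof -
  have "cyc_torus n g (diag_act n s t) = diag_act n s (cyc_torus n g t)" for s
    using assms by (auto simp: fun_eq_iff cyc_torus_def diag_act_def rot_def[symmetric] rot_less)
  then show ?thesis unfolding coset_conv cyc_def by (auto simp: image_iff; metis)
qed

lemma cyc_add: "n > 0 \<Longrightarrow> cyc n g (cyc n h C) = cyc n (g + h) C"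
  by (simp add: cyc_def image_image cyc_torus_add)

text \<open>Reconciles the product of \<open>integer_mod_group n\<close>, which is reduced modulo
  \<open>n\<close>, with plain addition of integers.\<close>

lemma cyc_mod: "cyc n (g mod int n) C = cyc n g C"
  by (simp add: cyc_def cyc_torus_mod)

lemma cyc_0: "C \<in> topspace (torus_mod n) \<Longrightarrow> n > 0 \<Longrightarrow> cyc n 0 C = C"
  by (auto simp: topspace_torus_mod cyc_coset cyc_torus_0)

lemma cyc_action:
  assumes "n > 0" shows "continuous_action (torus_mod n) (integer_mod_group n) (cyc n)"
proof (intro continuous_action.intro group_integer_mod_group continuous_action_axioms.intro)
  fix g
  have "continuous_map (torus n) (torus_mod n) (cyc n g \<circ> coset n)"
    using continuous_map_compose[OF continuous_map_cyc_torus[OF assms, of g] continuous_map_coset]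
    by (simp add: o_def cyc_coset assms)
  then show "continuous_map (torus_mod n) (torus_mod n) (cyc n g)"
    unfolding torus_mod_def by (simp add: continuous_compose_quotient_map_eq[OF quotient_map_orbit])
qed (auto simp: cyc_0 cyc_mod cyc_add assms)

lemma finite_carrier_integer_mod_group: "n > 0 \<Longrightarrow> finite (carrier (integer_mod_group n))"
  by (simp add: carrier_integer_mod_group)

text \<open>Allows every integer, negative ones included, as a group element in arguments about
  orbits.\<close>

lemma orbit_cyc: 
  assumes "n > 0" shows "orbit (integer_mod_group n) (cyc n) C = range (\<lambda>g. cyc n g C)"
proof -
  have "cyc n g C \<in> orbit (integer_mod_group n) (cyc n) C" for g
    unfolding orbit_def using assms cyc_mod[of n g C]
    by (auto simp: carrier_integer_mod_group intro!: exI[of _ "g mod int n"])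
  then show ?thesis by (auto simp: orbit_def)
qed

text \<open>On cosets the value does not depend on the representative that \<open>SOME\<close> picks.\<close>

definition ratio :: "nat \<Rightarrow> nat \<Rightarrow> (nat \<Rightarrow> complex) set \<Rightarrow> complex" where
  "ratio i j C = (let s = SOME s. s \<in> C in s i / s j)"

lemma ratio_coset:
  assumes "t \<in> topspace (torus n)" "i < n" "j < n"
  shows "ratio i j (coset n t) = t i / t j"
proof -
  have "(SOME s. s \<in> coset n t) \<in> coset n t"
    using diag.orbit_self[OF assms(1)] by (rule someI[of "\<lambda>s. s \<in> coset n t"])
  then obtain s where "norm s = 1" "(SOME s. s \<in> coset n t) = diag_act n s t"
    by (auto simp: coset_conv)
  then show ?thesis using assms by (auto simp: ratio_def diag_act_apply)
qed

lemma continuous_map_ratio: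
  assumes "i < n" "j < n"
  shows "continuous_map (torus_mod n) euclidean (ratio i j)"
proof -
  have "continuous_map (torus n) euclidean (\<lambda>t. t i / t j)"
    using assms by (intro continuous_map_divide continuous_map_torus_coordinate) (auto dest: torus_nonzero)
  then have "continuous_map (torus n) euclidean (ratio i j \<circ> coset n)"
    by (rule continuous_map_eq) (simp add: ratio_coset assms)
  then show ?thesis
    unfolding torus_mod_def by (simp add: continuous_compose_quotient_map_eq[OF quotient_map_orbit])
qed

text \<open>The scalar \<open>s j / t j\<close> carries \<open>t\<close> to \<open>s\<close>. Hence
  the functions \<open>ratio i j\<close> with \<open>j\<close> fixed determine a coset.\<close>

lemma coset_eqI:
  assumes "s \<in> topspace (torus n)" "t \<in> topspace (torus n)" "j < n"
    and "\<And>i. i < n \<Longrightarrow> s i / s j = t i / t j"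
  shows "coset n s = coset n t"
proof -
  have "s = diag_act n (s j / t j) t"
  proof (rule torus_eqI[of _ n])
    show "diag_act n (s j / t j) t \<in> topspace (torus n)"
      using assms(1-3) by (intro diag.act_closed) (auto simp: norm_divide torus_norm)
    fix i assume "i < n"
    then show "s i = diag_act n (s j / t j) t i"
      using assms(4)[of i] torus_nonzero[OF assms(1,3)] torus_nonzero[OF assms(2,3)]
      by (auto simp: diag_act_apply field_simps)
  qed fact
  moreover have "norm (s j / t j) = 1" using assms(1-3) by (simp add: norm_divide torus_norm)
  ultimately show ?thesis using coset_eq_iff[OF assms(1,2)] by blast
qed

text \<open>The acting circle is infinite, so \<open>Hausdorff_orbit_space\<close> does not apply;
  the continuous ratios with coordinate 0 separate cosets instead.\<close>

lemma Hausdorff_torus_mod: assumes "n > 0" shows "Hausdorff_space (torus_mod n)"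
proof (rule Hausdorff_space_separating)
  fix C D assume "C \<in> topspace (torus_mod n)" "D \<in> topspace (torus_mod n)" "C \<noteq> D"
  then obtain s t where st: "s \<in> topspace (torus n)" "t \<in> topspace (torus n)" "C = coset n s" "D = coset n t"
    by (auto simp: topspace_torus_mod)
  then obtain i where "i < n" "s i / s 0 \<noteq> t i / t 0"
    using coset_eqI[of s n t 0] assms \<open>C \<noteq> D\<close> by auto
  then show "\<exists>f. continuous_map (torus_mod n) (euclidean :: complex topology) f \<and> f C \<noteq> f D"
    using st assms by (intro exI[of _ "ratio i 0"]) (auto simp: ratio_coset continuous_map_ratio)
qed

section \<open>Affine maps and boxes in Euclidean space\<close>

lemma continuous_map_Euclidean_coordinate: "continuous_map (Euclidean_space m) euclideanreal (\<lambda>x. x i)"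
  unfolding Euclidean_space_def
  by (intro continuous_map_from_subtopology continuous_map_product_projection) simp

lemma continuous_map_into_Euclidean_space:
  assumes "\<And>i. continuous_map X euclideanreal (\<lambda>x. f x i)" "\<And>x i. x \<in> topspace X \<Longrightarrow> m \<le> i \<Longrightarrow> f x i = 0"
  shows "continuous_map X (Euclidean_space m) f"
  using assms unfolding Euclidean_space_def
  by (auto simp: continuous_map_in_subtopology continuous_map_componentwise_UNIV)

text \<open>Angles, shifts, translations and their inverses all have affine coordinates, so this
  class, with its few closure rules, carries all the smoothness proofs.\<close>

definition affine_fun_on :: "nat \<Rightarrow> (nat \<Rightarrow> real) set \<Rightarrow> ((nat \<Rightarrow> real) \<Rightarrow> real) \<Rightarrow> bool" where
  "affine_fun_on m U f \<longleftrightarrow> (\<exists>c a. \<forall>x\<in>U. f x = c + (\<Sum>j<m. a j * x j))"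

lemma affine_fun_on_const: "(\<And>x. x \<in> U \<Longrightarrow> f x = c) \<Longrightarrow> affine_fun_on m U f"
  unfolding affine_fun_on_def by (rule exI[of _ c], rule exI[of _ "\<lambda>_. 0"]) simp

lemma affine_fun_on_coordinate:
  assumes "U \<subseteq> topspace (Euclidean_space m)" shows "affine_fun_on m U (\<lambda>x. x i)"
  unfolding affine_fun_on_def
proof (intro exI ballI)
  fix x assume "x \<in> U"
  \<comment> \<open>Coordinates from \<open>m\<close> on vanish identically; for them the
    coefficients below are all zero.\<close>
  then have "i \<ge> m \<Longrightarrow> x i = 0" using assms by (auto simp: topspace_Euclidean_space)
  then show "x i = 0 + (\<Sum>j<m. (if j = i then 1 else 0) * x j)"
    by (cases "i < m") (simp_all add: if_distrib[of "\<lambda>z. z * _"] sum.delta cong: if_cong)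
qed

lemma affine_fun_on_add:
  assumes "affine_fun_on m U f" "affine_fun_on m U g" shows "affine_fun_on m U (\<lambda>x. f x + g x)"
proof -
  obtain c a c' a' where "\<forall>x\<in>U. f x = c + (\<Sum>j<m. a j * x j)" "\<forall>x\<in>U. g x = c' + (\<Sum>j<m. a' j * x j)"
    using assms unfolding affine_fun_on_def by blast
  then have "\<forall>x\<in>U. f x + g x = (c + c') + (\<Sum>j<m. (a j + a' j) * x j)"
    by (simp add: algebra_simps sum.distrib)
  then show ?thesis unfolding affine_fun_on_def by (intro exI) assumption
qed

lemma affine_fun_on_uminus:
  assumes "affine_fun_on m U f" shows "affine_fun_on m U (\<lambda>x. - f x)"
proof -
  obtain c a where "\<forall>x\<in>U. f x = c + (\<Sum>j<m. a j * x j)"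
    using assms unfolding affine_fun_on_def by blast
  then have "\<forall>x\<in>U. - f x = (- c) + (\<Sum>j<m. (- a j) * x j)"
    by (simp add: sum_negf)
  then show ?thesis unfolding affine_fun_on_def by (intro exI) assumption
qed

lemma affine_fun_on_diff:
  assumes "affine_fun_on m U f" "affine_fun_on m U g" shows "affine_fun_on m U (\<lambda>x. f x - g x)"
  using affine_fun_on_add[OF assms(1) affine_fun_on_uminus[OF assms(2)]] by simp

lemma affine_fun_on_cong: "affine_fun_on m U f \<Longrightarrow> (\<And>x. x \<in> U \<Longrightarrow> g x = f x) \<Longrightarrow> affine_fun_on m U g"
  unfolding affine_fun_on_def by simp

text \<open>The partial derivatives are constants, which are again affine, so induction on the order
  closes.\<close>

lemma Ck_on_affine:
  assumes U: "openin (Euclidean_space m) U" and f: "affine_fun_on m U f"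
  shows "Ck_on m r U f"
  using f
proof (induction r arbitrary: f)
  have cont: "continuous_map (subtopology (Euclidean_space m) U) euclideanreal f"
    if f: "affine_fun_on m U f" for f
  proof -
    obtain c a where eq: "\<forall>x\<in>U. f x = c + (\<Sum>j<m. a j * x j)"
      using f unfolding affine_fun_on_def by blast
    have "continuous_map (subtopology (Euclidean_space m) U) euclideanreal (\<lambda>x. c + (\<Sum>j<m. a j * x j))"
      by (intro continuous_intros continuous_map_from_subtopology continuous_map_Euclidean_coordinate) auto
    then show ?thesis by (rule continuous_map_eq) (simp add: eq)
  qed
  case 0 then show ?case by (simp add: cont)
  case (Suc r)
  obtain c a where eq: "\<forall>x\<in>U. f x = c + (\<Sum>j<m. a j * x j)"
    using Suc.prems unfolding affine_fun_on_def by blast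
  have "((\<lambda>s. f (x(j := s))) has_real_derivative a j) (at (x j))" if j: "j < m" and x: "x \<in> U" for j x
  proof -
    have x0: "i \<ge> m \<Longrightarrow> x i = 0" for i
      using x openin_subset[OF U] by (auto simp: topspace_Euclidean_space)
    \<comment> \<open>The affine formula for \<open>f\<close> is known on \<open>U\<close> only.
      Since \<open>U\<close> is open, the line through \<open>x\<close> in direction
      \<open>j\<close> stays in \<open>U\<close> for \<open>s\<close> near \<open>x j\<close>, which
      is enough for the derivative.\<close>
    have "continuous_map euclideanreal (Euclidean_space m) (\<lambda>s. x(j := s))"
    proof (rule continuous_map_into_Euclidean_space)
      show "continuous_map euclideanreal euclideanreal (\<lambda>s. (x(j := s)) i)" for i
        by (cases "i = j") auto
    qed (use x0 j in auto)
    from openin_continuous_map_preimage[OF this U] have op: "open {s. x(j := s) \<in> U}" by simp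
    show ?thesis
    proof (rule has_field_derivative_transform_within_open[OF _ op])
      have sum_eq: "(\<Sum>l<m. a l * (x(j := s)) l) = (\<Sum>l<m. a l * x l) + a j * (s - x j)" for s
      proof -
        have "(\<Sum>l<m. a l * (x(j := s)) l) - (\<Sum>l<m. a l * x l) = (\<Sum>l<m. if l = j then a j * (s - x j) else 0)"
          unfolding sum_subtractf[symmetric] by (rule sum.cong) (auto simp: algebra_simps)
        then show ?thesis using j by simp
      qed
      have "((\<lambda>s. c + ((\<Sum>l<m. a l * x l) + a j * (s - x j))) has_real_derivative a j) (at (x j))"
        by (auto intro!: derivative_eq_intros)
      then show "((\<lambda>s. c + (\<Sum>l<m. a l * (x(j := s)) l)) has_real_derivative a j) (at (x j))"
        unfolding sum_eq .
    qed (use x eq in auto)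
  qed
  moreover have "Ck_on m r U (\<lambda>x. a j)" for j
    by (intro Suc.IH affine_fun_on_const) simp
  ultimately have "\<exists>f'. \<forall>j<m. (\<forall>x\<in>U. ((\<lambda>s. f (x(j := s))) has_real_derivative f' j x) (at (x j)))
                 \<and> Ck_on m r U (f' j)"
    by (intro exI[of _ "\<lambda>j x. a j"]) auto
  then show ?case using cont[OF Suc.prems] by simp
qed

lemma smooth_fun_on_affine: "openin (Euclidean_space m) U \<Longrightarrow> affine_fun_on m U f \<Longrightarrow> smooth_fun_on m U f"
  by (simp add: smooth_fun_on_def Ck_on_affine)

text \<open>Since the last of the \<open>d\<close> coordinates vanishes, bounding all differences of coordinates also bounds
  the coordinates themselves; unlike a cube, the result is invariant under the cyclic shift below.\<close>

definition dbox :: "nat \<Rightarrow> real \<Rightarrow> (nat \<Rightarrow> real) set" where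
  "dbox d \<epsilon> = {x \<in> topspace (Euclidean_space (d - 1)). \<forall>i<d. \<forall>j<d. \<bar>x i - x j\<bar> < \<epsilon>}"

lemma dbox_subset: "dbox d \<epsilon> \<subseteq> topspace (Euclidean_space (d - 1))"
  by (auto simp: dbox_def)

lemma zero_in_dbox: "\<epsilon> > 0 \<Longrightarrow> (\<lambda>_. 0) \<in> dbox d \<epsilon>"
  by (simp add: dbox_def topspace_Euclidean_space)

lemma dbox_mono: "\<delta> \<le> \<epsilon> \<Longrightarrow> dbox d \<delta> \<subseteq> dbox d \<epsilon>"
  by (fastforce simp: dbox_def)

lemma openin_dbox: "openin (Euclidean_space (d - 1)) (dbox d \<epsilon>)"
proof -
  let ?E = "Euclidean_space (d - 1)"
  have abs_less_iff_interval: "\<bar>y\<bar> < \<epsilon> \<longleftrightarrow> y \<in> {-\<epsilon><..<\<epsilon>}" for y by auto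
  have "dbox d \<epsilon> = topspace ?E \<inter> (\<Inter>(i,j)\<in>{..<d} \<times> {..<d}. {x \<in> topspace ?E. x i - x j \<in> {-\<epsilon><..<\<epsilon>}})"
    unfolding dbox_def abs_less_iff_interval by blast
  also have "openin ?E \<dots>"
  proof (cases "d = 0")
    case False
    have "openin ?E {x \<in> topspace ?E. x i - x j \<in> {-\<epsilon><..<\<epsilon>}}" for i j
      by (rule openin_continuous_map_preimage[where Y=euclideanreal])
         (auto intro!: continuous_map_diff continuous_map_Euclidean_coordinate)
    then show ?thesis using False by (intro openin_Int openin_topspace openin_Inter) auto
  qed simp
  finally show ?thesis .
qed

text \<open>The box is star-shaped about the origin: it is the union of the segments from 0 to its
  points.\<close>

lemma connectedin_dbox:
  assumes "\<epsilon> > 0" shows "connectedin (Euclidean_space (d - 1)) (dbox d \<epsilon>)"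
proof -
  let ?seg = "\<lambda>x::nat \<Rightarrow> real. (\<lambda>s i. s * x i) ` {0..1}"
  have in_box: "?seg x \<subseteq> dbox d \<epsilon>" if "x \<in> dbox d \<epsilon>" for x
  proof clarify
    fix s :: real assume s: "s \<in> {0..1}"
    have "\<bar>s * x i - s * x j\<bar> < \<epsilon>" if ij: "i < d" "j < d" for i j
    proof -
      have "\<bar>s * x i - s * x j\<bar> = s * \<bar>x i - x j\<bar>"
        using s by (simp add: right_diff_distrib[symmetric] abs_mult)
      also have "\<dots> \<le> 1 * \<bar>x i - x j\<bar>" using s by (intro mult_right_mono) auto
      finally show ?thesis using that \<open>x \<in> dbox d \<epsilon>\<close> by (force simp: dbox_def)
    qed
    then show "(\<lambda>i. s * x i) \<in> dbox d \<epsilon>"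
      using \<open>x \<in> dbox d \<epsilon>\<close> by (simp add: dbox_def topspace_Euclidean_space)
  qed
  have "connectedin (Euclidean_space (d - 1)) (\<Union>x\<in>dbox d \<epsilon>. ?seg x)"
  proof (rule connectedin_Union)
    fix S assume "S \<in> (\<lambda>x. ?seg x) ` dbox d \<epsilon>"
    then obtain x where x: "x \<in> dbox d \<epsilon>" "S = ?seg x" by blast
    have "continuous_map euclideanreal (Euclidean_space (d - 1)) (\<lambda>s i. s * x i)"
      using x(1) by (intro continuous_map_into_Euclidean_space)
        (auto simp: dbox_def topspace_Euclidean_space intro!: continuous_intros)
    then show "connectedin (Euclidean_space (d - 1)) S"
      unfolding x(2) by (rule connectedin_continuous_map_image) simp
  next
    have "(\<lambda>_. 0) \<in> ?seg x" for x by (auto simp: image_iff intro!: bexI[of _ 0])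
    then show "\<Inter> ((\<lambda>x. ?seg x) ` dbox d \<epsilon>) \<noteq> {}" by blast
  qed
  moreover have "(\<Union>x\<in>dbox d \<epsilon>. ?seg x) = dbox d \<epsilon>"
  proof (intro equalityI subsetI)
    fix x assume "x \<in> dbox d \<epsilon>"
    moreover have "x \<in> ?seg x" by (auto simp: image_iff intro!: bexI[of _ 1])
    ultimately show "x \<in> (\<Union>x\<in>dbox d \<epsilon>. ?seg x)" by blast
  qed (use in_box in blast)
  ultimately show ?thesis by simp
qed

text \<open>A basic open set of the infinite product restricts every coordinate by some
  \<open>e i\<close>. In a box only coordinates below \<open>d - 1\<close> can be nonzero, so a
  minimum over finitely many indices suffices.\<close>

lemma dbox_neighbourhood:
  assumes V: "openin (Euclidean_space (d - 1)) V" "(\<lambda>_. 0) \<in> V" and d: "d > 0"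
  shows "\<exists>\<epsilon>>0. dbox d \<epsilon> \<subseteq> V"
proof -
  obtain T where T: "openin (powertop_real UNIV) T" "V = T \<inter> topspace (Euclidean_space (d - 1))"
    using V(1) unfolding Euclidean_space_def openin_subtopology by auto
  obtain X where X: "(\<lambda>_. 0) \<in> PiE UNIV X" "\<And>i. open (X i)" "PiE UNIV X \<subseteq> T"
    using product_topology_open_contains_basis[OF T(1)] V(2) T(2)
    by (metis (no_types, lifting) Int_iff open_openin)
  have "\<exists>e>0. \<forall>y. \<bar>y\<bar> < e \<longrightarrow> y \<in> X i" for i
  proof -
    have "0 \<in> X i" using X(1) by (simp add: PiE_iff)
    then show ?thesis using X(2)[of i] by (fastforce simp: open_dist dist_real_def)
  qed
  then obtain e where e: "\<And>i. e i > 0" "\<And>i y. \<bar>y\<bar> < e i \<Longrightarrow> y \<in> X i" by metis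
  define \<epsilon> where "\<epsilon> = Min (e ` {..<d})"
  have "\<epsilon> > 0" using d e(1) unfolding \<epsilon>_def by (subst Min_gr_iff) (auto simp: lessThan_empty_iff)
  have le: "\<epsilon> \<le> e i" if "i < d" for i unfolding \<epsilon>_def using that by simp
  have "x \<in> V" if x: "x \<in> dbox d \<epsilon>" for x
  proof -
    have x0: "x i = 0" if "i \<ge> d - 1" for i using x that by (auto simp: dbox_def topspace_Euclidean_space)
    have "x i \<in> X i" for i
    proof (cases "i < d")
      case True
      \<comment> \<open>Comparison with the last coordinate, which is 0, turns a bound on
        differences into one on \<open>x i\<close>.\<close>
      then have "\<bar>x i - x (d - 1)\<bar> < \<epsilon>" using x d by (auto simp: dbox_def)
      then show ?thesis using x0[of "d - 1"] le[OF True] e(2)[of "x i" i] by force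
    next
      case False then show ?thesis using x0[of i] e(1)[of i] e(2)[of "x i" i] by simp
    qed
    then show "x \<in> V" using X(3) T(2) x dbox_subset[of d \<epsilon>] by auto
  qed
  then show ?thesis using \<open>\<epsilon> > 0\<close> by blast
qed

text \<open>The cyclic shift of \<open>\<real>\<^sup>d/\<real>(1,\<dots>,1)\<close>, in the representatives with last coordinate \<open>0\<close>.\<close>

definition shift :: "nat \<Rightarrow> int \<Rightarrow> (nat \<Rightarrow> real) \<Rightarrow> nat \<Rightarrow> real" where
  "shift d g x = (\<lambda>i. if i < d then x (rot d g i) - x (rot d g (d - 1)) else 0)"

lemma shift_Euclidean: "d > 0 \<Longrightarrow> shift d g x \<in> topspace (Euclidean_space (d - 1))"
proof -
  assume "d > 0"
  have "i = d - 1" if "d - 1 \<le> i" "i < d" for i using that by simp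
  then show ?thesis by (auto simp: shift_def topspace_Euclidean_space)
qed

lemma shift_add: "d > 0 \<Longrightarrow> shift d g (shift d h x) = shift d (g + h) x"
  by (auto simp: shift_def fun_eq_iff rot_less rot_rot)

lemma shift_mod: "shift d (g mod int d) x = shift d g x"
  by (simp add: shift_def rot_mod fun_eq_iff)

lemma shift_0: "x \<in> topspace (Euclidean_space (d - 1)) \<Longrightarrow> shift d 0 x = x"
  by (auto simp: shift_def fun_eq_iff rot_0 topspace_Euclidean_space)

lemma shift_uminus:
  "d > 0 \<Longrightarrow> x \<in> topspace (Euclidean_space (d - 1)) \<Longrightarrow> shift d g (shift d (- g) x) = x"
  "d > 0 \<Longrightarrow> x \<in> topspace (Euclidean_space (d - 1)) \<Longrightarrow> shift d (- g) (shift d g x) = x"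
  by (simp_all add: shift_add shift_0)

lemma shift_dbox: "d > 0 \<Longrightarrow> x \<in> dbox d \<epsilon> \<Longrightarrow> shift d g x \<in> dbox d \<epsilon>"
  using shift_Euclidean[of d g x] unfolding dbox_def by (auto simp: shift_def rot_less)

lemma continuous_map_shift:
  assumes "d > 0"
  shows "continuous_map (Euclidean_space (d - 1)) (Euclidean_space (d - 1)) (shift d g)"
proof (rule continuous_map_into_Euclidean_space)
  fix i show "continuous_map (Euclidean_space (d - 1)) euclideanreal (\<lambda>x. shift d g x i)"
    by (cases "i < d") (auto simp: shift_def intro!: continuous_map_diff continuous_map_Euclidean_coordinate)
next
  fix x i assume "d - 1 \<le> i"
  then show "shift d g x i = 0" using shift_Euclidean[OF assms, of g x] by (simp add: topspace_Euclidean_space)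
qed

lemma affine_fun_on_shift:
  assumes "\<And>i. affine_fun_on m U (\<lambda>x. f x i)" shows "affine_fun_on m U (\<lambda>x. shift d g (f x) i)"
  by (cases "i < d") (simp_all add: shift_def affine_fun_on_diff assms affine_fun_on_const)

text \<open>The inverse subtracts \<open>u\<close> and shifts back, so it is affine too, and the
  image is open as the preimage of the small box under it. The spread of \<open>u\<close> plus that
  of a shifted point stays below \<open>\<epsilon>\<close>.\<close>

lemma smooth_open_embedding_dbox:
  assumes d: "d > 0" and u: "u \<in> topspace (Euclidean_space (d - 1))"
    and \<delta>: "\<And>i j. i < d \<Longrightarrow> j < d \<Longrightarrow> \<bar>u i - u j\<bar> + \<delta> \<le> \<epsilon>"
  shows "smooth_open_embedding (d - 1) (dbox d \<delta>) (dbox d \<epsilon>) (\<lambda>w i. u i + shift d g w i)"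
proof -
  let ?m = "d - 1" and ?E = "Euclidean_space (d - 1)" and ?U = "dbox d \<delta>"
  let ?f = "\<lambda>w i. u i + shift d g w i" and ?h = "\<lambda>x. shift d (- g) (\<lambda>i. x i - u i)"
  have diffE: "(\<lambda>i. x i - u i) \<in> topspace ?E" if "x \<in> topspace ?E" for x
    using that u by (simp add: topspace_Euclidean_space)
  have fE: "?f w \<in> topspace ?E" for w
    using shift_Euclidean[OF d, of g w] u by (simp add: topspace_Euclidean_space)
  have hf: "?h (?f w) = w" if "w \<in> ?U" for w
    using that dbox_subset[of d \<delta>] shift_uminus(2)[OF d] by auto
  have fh: "?f (?h x) = x" if "x \<in> topspace ?E" for x
    using shift_uminus(1)[OF d diffE[OF that], of g] by simp
  have image: "?f ` ?U = {x \<in> topspace ?E. ?h x \<in> ?U}"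
  proof (intro equalityI subsetI)
    fix x assume "x \<in> ?f ` ?U"
    then show "x \<in> {x \<in> topspace ?E. ?h x \<in> ?U}" using fE hf by auto
  next
    fix x assume "x \<in> {x \<in> topspace ?E. ?h x \<in> ?U}"
    then show "x \<in> ?f ` ?U" using fh[of x] by (auto simp: image_iff intro!: bexI[of _ "?h x"])
  qed
  have "continuous_map ?E ?E (\<lambda>x i. x i - u i)"
    using u by (intro continuous_map_into_Euclidean_space continuous_map_diff continuous_map_Euclidean_coordinate)
      (auto simp: topspace_Euclidean_space)
  from openin_continuous_map_preimage[OF continuous_map_compose[OF this continuous_map_shift[OF d, of "- g"]] openin_dbox[of d \<delta>]]
  have op: "openin ?E (?f ` ?U)"
    unfolding image o_def .
  have inj: "inj_on ?f ?U" by (rule inj_on_inverseI[of _ ?h]) (rule hf)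
  have inv: "inv_into ?U ?f x = ?h x" if "x \<in> ?f ` ?U" for x
    using that hf inv_into_f_f[OF inj] by auto
  have f_box: "?f w \<in> dbox d \<epsilon>" if w: "w \<in> ?U" for w
  proof -
    have "\<bar>?f w i - ?f w j\<bar> < \<epsilon>" if ij: "i < d" "j < d" for i j
    proof -
      have "\<bar>shift d g w i - shift d g w j\<bar> < \<delta>" using shift_dbox[OF d w, of g] ij by (simp add: dbox_def)
      then show ?thesis using \<delta>[OF ij] by linarith
    qed
    then show ?thesis using fE[of w] by (simp add: dbox_def)
  qed
  have coord: "affine_fun_on ?m V (\<lambda>x. x i)" if "V \<subseteq> topspace ?E" for V i
    using that by (rule affine_fun_on_coordinate)
  have "smooth_map_on ?m ?U (dbox d \<epsilon>) ?f"
    unfolding smooth_map_on_def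
  proof (intro conjI allI impI smooth_fun_on_affine[OF openin_dbox])
    show "?f \<in> ?U \<rightarrow> dbox d \<epsilon>" using f_box by blast
    show "affine_fun_on ?m ?U (\<lambda>w. ?f w j)" for j
      by (intro affine_fun_on_add affine_fun_on_const[of _ _ "u j"] affine_fun_on_shift coord dbox_subset) simp
  qed
  moreover have "smooth_map_on ?m (?f ` ?U) ?U (inv_into ?U ?f)"
    unfolding smooth_map_on_def
  proof (intro conjI allI impI smooth_fun_on_affine[OF op])
    show "inv_into ?U ?f \<in> ?f ` ?U \<rightarrow> ?U" using inv_into_into[of _ ?f ?U] by blast
    fix j
    show "affine_fun_on ?m (?f ` ?U) (\<lambda>x. inv_into ?U ?f x j)"
    proof (rule affine_fun_on_cong[where f="\<lambda>x. ?h x j"])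
      show "affine_fun_on ?m (?f ` ?U) (\<lambda>x. ?h x j)"
        by (intro affine_fun_on_shift affine_fun_on_diff coord openin_subset[OF op])
           (rule affine_fun_on_const, rule refl)
    qed (simp add: inv)
  qed
  ultimately show ?thesis unfolding smooth_open_embedding_def using op inj by simp
qed

section \<open>The spaces of twisted periodic points\<close>

text \<open>By Bezout, \<open>x\<close> jumps of length \<open>k\<close> amount to one jump of
  length \<open>gcd k n\<close> modulo \<open>n\<close>. Jumps of this length then lead from
  \<open>i mod gcd k n\<close> up to \<open>i\<close> without leaving the range below
  \<open>n\<close>.\<close>

lemma periodic_mod_gcd:
  fixes n k :: nat
  assumes k: "k > 0" and n: "n > 0" and per: "\<And>i. i < n \<Longrightarrow> f ((i + k) mod n) = f i" and i: "i < n"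
  shows "f i = f (i mod gcd k n)"
proof -
  let ?d = "gcd k n"
  obtain x y where xy: "k * x = n * y + ?d" using bezout_nat[of k n] k by auto
  have iter: "f ((i + j * k) mod n) = f i" if "i < n" for i j
  proof (induction j)
    case (Suc j)
    have "f ((i + Suc j * k) mod n) = f (((i + j * k) mod n + k) mod n)"
      by (simp add: mod_simps algebra_simps)
    also have "\<dots> = f ((i + j * k) mod n)" using n by (intro per) simp
    finally show ?case using Suc by simp
  qed (use that in simp)
  have step: "f (i + ?d) = f i" if "i + ?d < n" for i
  proof -
    have "i + x * k = i + ?d + n * y" using xy by (simp add: mult.commute)
    then have "(i + x * k) mod n = (i + ?d + n * y) mod n" by (simp add: add.assoc)
    also have "\<dots> = i + ?d" using that by simp
    finally show ?thesis using iter[of i x] that by simp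
  qed
  have "f (r + ?d * q) = f r" if "r + ?d * q < n" for r q
    using that
  proof (induction q)
    case (Suc q)
    then show ?case using step[of "r + ?d * q"] by (simp add: algebra_simps)
  qed simp
  from this[of "i mod ?d" "i div ?d"] show ?thesis using i by simp
qed

text \<open>Defined on points of the torus, before passing to cosets, so that successive twists add
  their exponents exactly.\<close>

definition twist :: "nat \<Rightarrow> nat \<Rightarrow> (nat \<Rightarrow> complex) \<Rightarrow> (nat \<Rightarrow> real) \<Rightarrow> nat \<Rightarrow> complex" where
  "twist n d t x = (\<lambda>i\<in>{..<n}. t i * cis (x (i mod d)))"

lemma twist_apply: "i < n \<Longrightarrow> twist n d t x i = t i * cis (x (i mod d))"
  by (simp add: twist_def)

lemma twist_in_torus: "t \<in> topspace (torus n) \<Longrightarrow> twist n d t x \<in> topspace (torus n)"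
  by (auto simp: topspace_torus twist_def norm_mult PiE_iff)

lemma twist_twist: "twist n d (twist n d t u) w = twist n d t (\<lambda>i. u i + w i)"
  by (auto simp: twist_def cis_mult fun_eq_iff)

lemma twist_0: "t \<in> topspace (torus n) \<Longrightarrow> twist n d t (\<lambda>_. 0) = t"
  by (rule torus_eqI[of _ n]) (auto simp: twist_in_torus twist_apply)

lemma continuous_map_twist:
  assumes "t \<in> topspace (torus n)"
  shows "continuous_map (Euclidean_space m) (torus n) (twist n d t)"
proof -
  have "continuous_map (Euclidean_space m) euclidean (\<lambda>x. t i * cis (x (i mod d)))" for i
    by (rule continuous_map_continuous_on_compose[OF continuous_map_Euclidean_coordinate, where S=UNIV])
       (auto intro!: continuous_intros)
  then show ?thesis unfolding twist_def continuous_map_into_torus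
    using assms by (auto simp: norm_mult torus_norm)
qed

text \<open>On the torus the two sides differ by the scalar
  \<open>cis (x (rot d g (d - 1)))\<close>, since \<open>shift\<close> subtracts this exponent to
  make the last one zero. Only the cosets agree.\<close>

lemma cyc_twist:
  assumes n: "n > 0" and d: "d dvd n" and t: "t \<in> topspace (torus n)"
  shows "cyc n g (coset n (twist n d t x)) = coset n (twist n d (cyc_torus n g t) (shift d g x))"
proof -
  have d0: "d > 0" using n d by (auto intro: Nat.gr0I)
  let ?c = "cis (x (rot d g (d - 1)))"
  have "cyc_torus n g (twist n d t x) = diag_act n ?c (twist n d (cyc_torus n g t) (shift d g x))"
  proof (rule torus_eqI[of _ n])
    show "diag_act n ?c (twist n d (cyc_torus n g t) (shift d g x)) \<in> topspace (torus n)"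
      by (intro diag.act_closed twist_in_torus cyc_torus_in n t) simp
    fix i assume i: "i < n"
    have "?c * cis (shift d g x (i mod d)) = cis (x (rot d g (i mod d)))"
      using d0 by (simp add: shift_def cis_mult)
    then show "cyc_torus n g (twist n d t x) i = diag_act n ?c (twist n d (cyc_torus n g t) (shift d g x)) i"
      using i n by (simp add: cyc_torus_apply diag_act_apply twist_apply rot_less rot_mod_dvd[OF n d] mult.left_commute)
  qed (intro cyc_torus_in twist_in_torus n t)
  then show ?thesis
    using n t by (simp add: cyc_coset coset_diag_act cyc_torus_in twist_in_torus)
qed

text \<open>The scalar relating \<open>s\<close> and \<open>t\<close> passes through the twist, so a
  parametrization depends only on the coset of its base point.\<close>

lemma coset_twist_cong:
  assumes "s \<in> topspace (torus n)" "t \<in> topspace (torus n)" "coset n s = coset n t"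
  shows "coset n (twist n d s x) = coset n (twist n d t x)"
proof -
  obtain c where c: "norm c = 1" "s = diag_act n c t" using coset_eq_iff assms by blast
  have "twist n d s x = diag_act n c (twist n d t x)"
    by (auto simp: c(2) twist_def diag_act_def fun_eq_iff)
  then show ?thesis using c assms by (simp add: coset_diag_act twist_in_torus)
qed

section \<open>Solutions of the twisted periodicity\<close>

definition sol :: "nat \<Rightarrow> nat \<Rightarrow> complex \<Rightarrow> (nat \<Rightarrow> complex) set" where
  "sol n k \<omega> = {t \<in> topspace (torus n). \<forall>i<n. t ((i + k) mod n) = inverse \<omega> * t i}"

lemma YY_conv: "YY n k \<omega> = coset n ` sol n k \<omega>"
  by (auto simp: YY_def sol_def)

lemma sol_torus: "t \<in> sol n k \<omega> \<Longrightarrow> t \<in> topspace (torus n)"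
  by (simp add: sol_def)

lemma sol_step: "\<lbrakk>t \<in> sol n k \<omega>; i < n\<rbrakk> \<Longrightarrow> t ((i + k) mod n) = inverse \<omega> * t i"
  by (simp add: sol_def)

lemma diag_act_sol: 
  assumes "norm c = 1" "t \<in> sol n k \<omega>" shows "diag_act n c t \<in> sol n k \<omega>"
proof -
  have "diag_act n c t \<in> topspace (torus n)" using assms by (intro diag.act_closed) (auto simp: sol_def)
  moreover have "(i + k) mod n < n" if "i < n" for i using that by simp
  ultimately show ?thesis using assms(2) by (simp add: sol_def diag_act_apply)
qed

text \<open>Twisted periodicity is unaffected by scalars, so any one representative decides.\<close>

lemma coset_in_YY:
  assumes "t \<in> topspace (torus n)" shows "coset n t \<in> YY n k \<omega> \<longleftrightarrow> t \<in> sol n k \<omega>"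
proof
  assume "coset n t \<in> YY n k \<omega>"
  then obtain s where s: "s \<in> sol n k \<omega>" "coset n t = coset n s" by (auto simp: YY_conv)
  then obtain c where "norm c = 1" "t = diag_act n c s" using assms coset_eq_iff sol_torus by metis
  then show "t \<in> sol n k \<omega>" using diag_act_sol s(1) by simp
qed (simp add: YY_conv)

lemma cyc_torus_sol:
  assumes n: "n > 0" and t: "t \<in> sol n k \<omega>" shows "cyc_torus n g t \<in> sol n k \<omega>"
proof -
  have "rot n g ((i + k) mod n) = (rot n g i + k) mod n" for i
    unfolding rot_uminus_nat[OF n, symmetric] rot_rot[OF n] by (simp add: add.commute)
  then show ?thesis
    using n t by (simp add: sol_def cyc_torus_in cyc_torus_apply rot_less)
qed

text \<open>A jump by \<open>k\<close> modulo \<open>n\<close> does not change the residue modulo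
  \<open>d\<close>, so the factors on both sides of the equation are equal.\<close>

lemma twist_sol:
  assumes "d dvd n" "d dvd k" "t \<in> sol n k \<omega>" shows "twist n d t x \<in> sol n k \<omega>"
proof -
  have "(i + k) mod n mod d = i mod d" for i
    using assms(1,2) by (metis add.right_neutral dvd_imp_mod_0 mod_add_right_eq mod_mod_cancel)
  then show ?thesis using assms(3) by (simp add: sol_def twist_in_torus twist_apply)
qed

lemma YY_subset: "YY n k \<omega> \<subseteq> topspace (torus_mod n)"
  using sol_torus by (auto simp: YY_conv topspace_torus_mod)

lemma cyc_YY: "n > 0 \<Longrightarrow> C \<in> YY n k \<omega> \<Longrightarrow> cyc n g C \<in> YY n k \<omega>"
  by (auto simp: YY_conv cyc_coset cyc_torus_sol)

text \<open>The equations cut out a closed, hence compact, subset of the torus, and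
  \<open>YY\<close> is its continuous image.\<close>

lemma compactin_YY: "compactin (torus_mod n) (YY n k \<omega>)"
proof (cases "n = 0")
  case False
  have closed: "closedin (torus n) {t \<in> topspace (torus n). t ((i + k) mod n) - inverse \<omega> * t i \<in> {0}}" if "i < n" for i
    using that by (intro closedin_continuous_map_preimage[where Y=euclidean])
      (auto intro!: continuous_map_diff continuous_map_mult continuous_map_torus_coordinate)
  have "sol n k \<omega> = (\<Inter>i\<in>{..<n}. {t \<in> topspace (torus n). t ((i + k) mod n) - inverse \<omega> * t i \<in> {0}})"
    using False by (auto simp: sol_def)
  then have "closedin (torus n) (sol n k \<omega>)" using closed False by (auto intro!: closedin_Inter)
  then have "compactin (torus n) (sol n k \<omega>)"
    using compact_torus closedin_compact_space by blast
  then show ?thesis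
    unfolding YY_conv using continuous_map_coset image_compactin by blast
next
  \<comment> \<open>With no coordinates there are no equations, and the intersection over an empty
    family would be the whole type; finiteness of the one-point torus settles this case.\<close>
  case True
  have "sol 0 k \<omega> \<subseteq> topspace (torus 0)" by (auto simp: sol_def)
  moreover have "finite (topspace (torus 0))" by (simp add: topspace_torus)
  ultimately have "finite (sol n k \<omega>)" using True finite_subset by blast
  then show ?thesis using YY_subset by (intro finite_imp_compactin) (auto simp: YY_conv)
qed

locale twisted =
  fixes n k d :: nat and \<omega> :: complex
  assumes n: "n > 0" and k: "k > 0" and d_eq: "d = gcd k n" and root: "\<omega> ^ (n div d) = 1"
begin

lemma d_dvd: "d dvd n" "d dvd k" by (simp_all add: d_eq)

lemma d_pos: "d > 0" using n by (simp add: d_eq)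

lemma d_le: "d \<le> n" using n d_dvd(1) dvd_imp_le by blast

lemma norm_omega: "norm \<omega> = 1"
proof -
  have "n div d > 0" using d_pos d_le by (simp add: div_greater_zero_iff)
  then show ?thesis using power_eq_1_iff[OF root] by auto
qed

text \<open>Take \<open>t i = \<eta> ^ (i div d)\<close>, constant on blocks of length
  \<open>d\<close>. The twist requires \<open>\<eta> ^ (k div d) = inverse \<omega>\<close>, and
  wrapping around at \<open>n\<close> requires \<open>\<eta> ^ (n div d) = 1\<close>.\<close>

lemma sol_nonempty: "sol n k \<omega> \<noteq> {}"
proof -
  obtain x y where xy: "k * x = n * y + d" using bezout_nat[of k n] k d_eq by auto
  define n' k' where "n' = n div d" and "k' = k div d"
  have nk: "n = d * n'" "k = d * k'" using d_dvd by (simp_all add: n'_def k'_def)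
  have "d * (k' * x) = d * (n' * y + 1)" using xy unfolding nk by (simp add: algebra_simps)
  then have k'x: "k' * x = n' * y + 1" using d_pos by (simp only: mult_cancel1) simp
  have \<omega>: "\<omega> ^ n' = 1" using root by (simp add: n'_def)
  \<comment> \<open>The Bezout coefficient \<open>x\<close> inverts \<open>k'\<close> modulo
    \<open>n'\<close>, so raising \<omega> to the power -x solves both equations.\<close>
  define \<eta> where "\<eta> = inverse (\<omega> ^ x)"
  have "\<eta> ^ n' = inverse ((\<omega> ^ n') ^ x)" by (simp add: \<eta>_def power_inverse power_mult[symmetric] mult.commute)
  then have \<eta>_n': "\<eta> ^ n' = 1" using \<omega> by simp
  have \<eta>_mod: "\<eta> ^ (a mod n') = \<eta> ^ a" for a
    using \<eta>_n' by (metis div_mult_mod_eq mult.commute mult_1 power_add power_mult power_one)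
  have "\<eta> ^ k' = inverse (\<omega> ^ (k' * x))" by (simp add: \<eta>_def power_inverse power_mult[symmetric] mult.commute)
  also have "\<omega> ^ (k' * x) = \<omega>" using \<omega> by (simp add: k'x power_add power_mult)
  finally have \<eta>_k': "\<eta> ^ k' = inverse \<omega>" .
  have "norm \<eta> = 1" by (simp add: \<eta>_def norm_inverse norm_power norm_omega)
  define t where "t = (\<lambda>i\<in>{..<n}. \<eta> ^ (i div d))"
  have "t \<in> topspace (torus n)" using \<open>norm \<eta> = 1\<close> by (auto simp: t_def topspace_torus norm_power)
  moreover have "t ((i + k) mod n) = inverse \<omega> * t i" if "i < n" for i
  proof -
    have "(i + k) mod n div d = ((i + k) div d) mod n'"
      by (simp add: nk(1) mod_mult2_eq d_pos)
    also have "(i + k) div d = i div d + k'" using d_pos by (simp add: nk(2))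
    finally have "t ((i + k) mod n) = \<eta> ^ ((i div d + k') mod n')" using n by (simp add: t_def)
    then show ?thesis using that by (simp add: \<eta>_mod power_add \<eta>_k' t_def)
  qed
  ultimately show ?thesis by (auto simp: sol_def)
qed

section \<open>Exponents as local coordinates on \<open>YY\<close>\<close>

abbreviation psi :: "(nat \<Rightarrow> complex) \<Rightarrow> (nat \<Rightarrow> real) \<Rightarrow> (nat \<Rightarrow> complex) set" where
  "psi t x \<equiv> coset n (twist n d t x)"

text \<open>Ratios remove the unknown scalar, and division by those of \<open>t\<close> removes the
  base point. On \<open>YY\<close> this is a right inverse of \<open>psi t\<close> everywhere, but
  \<open>Arg\<close> makes it a left inverse only on boxes of size at most \<pi>.\<close>

definition angles :: "(nat \<Rightarrow> complex) \<Rightarrow> (nat \<Rightarrow> complex) set \<Rightarrow> nat \<Rightarrow> real" where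
  "angles t C = (\<lambda>i. if i < d then Arg (ratio i (d - 1) C / (t i / t (d - 1))) else 0)"

lemma psi_in: "t \<in> sol n k \<omega> \<Longrightarrow> psi t x \<in> YY n k \<omega>"
  using twist_sol[OF d_dvd] by (auto simp: YY_conv)

lemma continuous_map_psi:
  "t \<in> topspace (torus n) \<Longrightarrow> continuous_map (Euclidean_space m) (torus_mod n) (psi t)"
  using continuous_map_compose[OF continuous_map_twist continuous_map_coset] by (auto simp: o_def)

text \<open>In \<open>s i / t i\<close> the two factors \<open>inverse \<omega>\<close> cancel, so
  this quotient is invariant under jumps by \<open>k\<close> and hence depends on
  \<open>i mod d\<close> alone. It has norm 1, so \<open>cis\<close> recovers it from its
  argument.\<close>

lemma psi_angles:
  assumes t: "t \<in> sol n k \<omega>" and s: "s \<in> sol n k \<omega>"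
  shows "angles t (coset n s) \<in> topspace (Euclidean_space (d - 1))" "psi t (angles t (coset n s)) = coset n s"
proof -
  note [simp] = sol_torus[OF t] sol_torus[OF s]
  have less: "i < d \<Longrightarrow> i < n" for i using d_le by simp
  have nz: "t i \<noteq> 0" "s i \<noteq> 0" if "i < n" for i using that torus_nonzero[of _ n] by auto
  let ?x = "angles t (coset n s)" and ?r = "\<lambda>i. s i / t i"
  have last: "d - 1 < d" "d - 1 < n" using d_pos less by auto
  have arg: "ratio i (d - 1) (coset n s) / (t i / t (d - 1)) = ?r i / ?r (d - 1)" if "i < d" for i
    using that last nz less by (simp add: ratio_coset[of s n] field_simps)
  have cis_x: "cis (?x i) = ?r i / ?r (d - 1)" if "i < d" for i
  proof -
    have "norm (?r i / ?r (d - 1)) = 1"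
      using less[OF that] last(2) by (simp add: norm_divide torus_norm[OF sol_torus[OF t]] torus_norm[OF sol_torus[OF s]] del: divide_divide_eq_left divide_divide_eq_right)
    moreover from this have "?r i / ?r (d - 1) \<noteq> 0" by (metis norm_zero zero_neq_one)
    ultimately show ?thesis using that arg[OF that] by (simp add: angles_def cis_Arg sgn_div_norm)
  qed
  have x_last: "?x (d - 1) = 0"
    using last nz by (simp add: angles_def ratio_coset[of s n] Arg_def)
  have "?x i = 0" if "i \<ge> d - 1" for i
    using that x_last by (cases "i = d - 1") (auto simp: angles_def)
  then show "?x \<in> topspace (Euclidean_space (d - 1))" by (simp add: topspace_Euclidean_space)
  have per: "?r i = ?r (i mod d)" if "i < n" for i
    unfolding d_eq
  proof (rule periodic_mod_gcd[where f="?r", OF k n _ that])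
    fix i assume "i < n"
    then show "?r ((i + k) mod n) = ?r i"
      using norm_omega by (auto simp: sol_step[OF t] sol_step[OF s])
  qed
  show "psi t ?x = coset n s"
  proof (rule coset_eqI[of _ n _ "d - 1"])
    fix i assume i: "i < n"
    have "twist n d t ?x i = t i * (?r i / ?r (d - 1))"
      using i d_pos per[OF i] by (simp add: twist_apply cis_x)
    moreover have "twist n d t ?x (d - 1) = t (d - 1)" using last x_last by (simp add: twist_apply)
    ultimately show "twist n d t ?x i / twist n d t ?x (d - 1) = s i / s (d - 1)"
      using nz i last(2) by simp
  qed (use last in \<open>auto simp: twist_in_torus\<close>)
qed

lemma psi_surj: 
  assumes "t \<in> sol n k \<omega>" shows "psi t ` topspace (Euclidean_space (d - 1)) = YY n k \<omega>"
proof (intro equalityI subsetI)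
  fix C assume "C \<in> YY n k \<omega>"
  then obtain s where "s \<in> sol n k \<omega>" "C = coset n s" by (auto simp: YY_conv)
  then show "C \<in> psi t ` topspace (Euclidean_space (d - 1))" using psi_angles[OF assms] by (metis imageI)
qed (use psi_in[OF assms] in auto)

lemma connectedin_YY: "connectedin (torus_mod n) (YY n k \<omega>)"
proof -
  obtain t where t: "t \<in> sol n k \<omega>" using sol_nonempty by blast
  have "connectedin (Euclidean_space (d - 1)) (topspace (Euclidean_space (d - 1)))"
    by (simp add: connectedin_topspace connected_Euclidean_space)
  from connectedin_continuous_map_image[OF continuous_map_psi[OF sol_torus[OF t]] this]
  show ?thesis unfolding psi_surj[OF t] .
qed

lemma ratio_psi:
  assumes t: "t \<in> topspace (torus n)" and x: "x \<in> topspace (Euclidean_space (d - 1))" and i: "i < d"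
  shows "ratio i (d - 1) (psi t x) / (t i / t (d - 1)) = cis (x i)"
proof -
  have less: "d - 1 < d" "d - 1 < n" "i < n" using i d_le by auto
  have "x (d - 1) = 0" using x by (simp add: topspace_Euclidean_space)
  then show ?thesis
    using i less torus_nonzero[OF t] by (simp add: ratio_coset[of _ n] twist_in_torus t twist_apply)
qed

lemma dbox_abs_less:
  assumes x: "x \<in> dbox d \<epsilon>" and i: "i < d" shows "\<bar>x i\<bar> < \<epsilon>"
proof -
  have "x (d - 1) = 0" using x by (simp add: dbox_def topspace_Euclidean_space)
  moreover have "\<bar>x i - x (d - 1)\<bar> < \<epsilon>" using x i by (simp add: dbox_def)
  ultimately show ?thesis by simp
qed

text \<open>Exponents of absolute value below \<pi> are principal values, so \<open>Arg\<close>
  returns them unchanged.\<close>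

lemma angles_psi:
  assumes t: "t \<in> topspace (torus n)" and x: "x \<in> dbox d pi"
  shows "angles t (psi t x) = x"
proof
  fix i
  have xE: "x \<in> topspace (Euclidean_space (d - 1))" using x by (simp add: dbox_def)
  show "angles t (psi t x) i = x i"
  proof (cases "i < d")
    case True
    have "Arg (cis (x i)) = x i"
      using dbox_abs_less[OF x True] by (intro cis_Arg_unique) (auto simp: sgn_div_norm)
    then show ?thesis unfolding angles_def ratio_psi[OF t xE True] using True by simp
  next
    case False
    then show ?thesis using xE by (simp add: angles_def topspace_Euclidean_space)
  qed
qed

text \<open>Keeps the ratios of points in a chart off the half-line where \<open>Arg\<close>
  jumps.\<close>

lemma cis_not_nonpos:
  assumes "\<bar>r\<bar> < pi" shows "cis r \<notin> \<real>\<^sub>\<le>\<^sub>0"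
proof
  assume "cis r \<in> \<real>\<^sub>\<le>\<^sub>0"
  then obtain q where q: "cis r = of_real q" "q \<le> 0" by (rule nonpos_Reals_cases)
  then have "\<bar>q\<bar> = 1" by (metis norm_cis norm_of_real)
  then have "cis r = -1" using q by (simp add: abs_if split: if_splits)
  then have "Arg (cis r) = pi" by (simp add: cis_Arg_unique)
  moreover have "Arg (cis r) = r" using assms by (intro cis_Arg_unique) (auto simp: sgn_div_norm)
  ultimately show False using assms by simp
qed

text \<open>Where the ratios avoid the cut, \<open>angles t\<close> is continuous and the image of
  \<open>V\<close> is its preimage of \<open>V\<close>. That every point of this preimage is hit
  follows because \<open>angles t\<close> is a right inverse of \<open>psi t\<close> on all of
  \<open>YY\<close>.\<close>

lemma openin_psi_image:
  assumes t: "t \<in> sol n k \<omega>" and V: "openin (Euclidean_space (d - 1)) V" "V \<subseteq> dbox d pi"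
  shows "openin (subtopology (torus_mod n) (YY n k \<omega>)) (psi t ` V)"
proof -
  let ?E = "Euclidean_space (d - 1)" and ?Y = "subtopology (torus_mod n) (YY n k \<omega>)"
  let ?q = "\<lambda>i C. ratio i (d - 1) C / (t i / t (d - 1))"
  note tT = sol_torus[OF t]
  have less: "i < d \<Longrightarrow> i < n" "d - 1 < n" for i using d_le d_pos by auto
  have cont: "continuous_map ?Y euclidean (?q i)" if "i < d" for i
    using that less torus_nonzero[OF tT]
    by (intro continuous_map_divide continuous_map_from_subtopology continuous_map_ratio) auto
  \<comment> \<open>The open part of \<open>YY\<close> on which every ratio lies in the domain of
    continuity of \<open>Arg\<close>.\<close>
  define D where "D = (\<Inter>i\<in>{..<d}. {C \<in> topspace ?Y. ?q i C \<in> - \<real>\<^sub>\<le>\<^sub>0})"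
  have D: "openin ?Y D"
    unfolding D_def
  proof (intro openin_Inter)
    fix W assume "W \<in> (\<lambda>i. {C \<in> topspace ?Y. ?q i C \<in> - \<real>\<^sub>\<le>\<^sub>0}) ` {..<d}"
    then obtain i where i: "i < d" "W = {C \<in> topspace ?Y. ?q i C \<in> - \<real>\<^sub>\<le>\<^sub>0}" by blast
    show "openin ?Y W" unfolding i(2)
      by (rule openin_continuous_map_preimage[OF cont[OF i(1)]]) (simp add: open_Compl)
  qed (use d_pos in auto)
  have cont_angles: "continuous_map (subtopology ?Y D) ?E (angles t)"
  proof (rule continuous_map_into_Euclidean_space)
    fix i
    show "continuous_map (subtopology ?Y D) euclideanreal (\<lambda>C. angles t C i)"
    proof (cases "i < d")
      case True
      have "continuous_on (- \<real>\<^sub>\<le>\<^sub>0) Arg" by (simp add: continuous_at_imp_continuous_on continuous_at_Arg)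
      from continuous_map_continuous_on_compose[OF continuous_map_from_subtopology[OF cont[OF True]] this]
      show ?thesis using True by (auto simp: angles_def D_def)
    qed (simp add: angles_def)
  next
    fix C i assume C: "C \<in> topspace (subtopology ?Y D)" and i: "d - 1 \<le> i"
    then have "C \<in> YY n k \<omega>" by auto
    then obtain s where "s \<in> sol n k \<omega>" "C = coset n s" by (auto simp: YY_conv)
    then show "angles t C i = 0" using psi_angles(1)[OF t] i by (auto simp: topspace_Euclidean_space)
  qed
  have "psi t ` V = {C \<in> topspace (subtopology ?Y D). angles t C \<in> V}"
  proof (intro equalityI subsetI)
    fix C assume "C \<in> psi t ` V"
    then obtain x where x: "x \<in> V" "C = psi t x" by blast
    then have xb: "x \<in> dbox d pi" "x \<in> topspace ?E" using V(2) by (auto simp: dbox_def)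
    have "?q i C \<notin> \<real>\<^sub>\<le>\<^sub>0" if "i < d" for i
      unfolding x(2) ratio_psi[OF tT xb(2) that] by (intro cis_not_nonpos dbox_abs_less[OF xb(1)] that)
    then have "C \<in> D"
      using psi_in[OF t, of x] YY_subset[of n k \<omega>] unfolding D_def x(2) by auto
    then show "C \<in> {C \<in> topspace (subtopology ?Y D). angles t C \<in> V}"
      using x(1) openin_subset[OF D] angles_psi[OF tT xb(1)] by (auto simp: x(2))
  next
    fix C assume C: "C \<in> {C \<in> topspace (subtopology ?Y D). angles t C \<in> V}"
    then obtain s where "s \<in> sol n k \<omega>" "C = coset n s" by (auto simp: YY_conv)
    then show "C \<in> psi t ` V" using psi_angles(2)[OF t] C by (metis (mono_tags, lifting) imageI mem_Collect_eq)
  qed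
  moreover have "openin (subtopology ?Y D) {C \<in> topspace (subtopology ?Y D). angles t C \<in> V}"
    by (rule openin_continuous_map_preimage[OF cont_angles V(1)])
  ultimately show ?thesis using D openin_open_subtopology by metis
qed

lemma inj_on_psi: "t \<in> sol n k \<omega> \<Longrightarrow> inj_on (psi t) (dbox d pi)"
  by (rule inj_on_inverseI[of _ "angles t"]) (simp add: angles_psi sol_torus)

text \<open>The angle of coordinate \<open>i\<close> is \<open>Arg (t i) + x (i mod d)\<close>,
  affine in \<open>x\<close>. The embedding property combines openness of images with injectivity on
  boxes of size at most \<pi>.\<close>

lemma smooth_param_psi:
  assumes t: "t \<in> sol n k \<omega>" and \<epsilon>: "\<epsilon> \<le> pi"
  shows "smooth_param n (YY n k \<omega>) (d - 1) (dbox d \<epsilon>) (psi t)"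
proof -
  let ?E = "Euclidean_space (d - 1)" and ?Y = "subtopology (torus_mod n) (YY n k \<omega>)" and ?U = "dbox d \<epsilon>"
  note tT = sol_torus[OF t]
  have sub: "?U \<subseteq> dbox d pi" using \<epsilon> by (rule dbox_mono)
  have top: "topspace (subtopology ?E ?U) = ?U" using dbox_subset[of d \<epsilon>] by auto
  have YY: "YY n k \<omega> \<inter> psi t ` ?U = psi t ` ?U" using psi_in[OF t] by blast
  have "embedding_map (subtopology ?E ?U) ?Y (psi t)"
  proof (rule injective_open_imp_embedding_map)
    show "continuous_map (subtopology ?E ?U) ?Y (psi t)"
      using continuous_map_psi[OF tT] psi_in[OF t]
      by (auto simp: continuous_map_in_subtopology continuous_map_from_subtopology)
    show "open_map (subtopology ?E ?U) ?Y (psi t)"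
      unfolding open_map_def openin_open_subtopology[OF openin_dbox]
      using openin_psi_image[OF t] sub by blast
    show "inj_on (psi t) (topspace (subtopology ?E ?U))"
      unfolding top using inj_on_psi[OF t] sub by (rule inj_on_subset)
  qed
  then have hom: "homeomorphic_map (subtopology ?E ?U) (subtopology (torus_mod n) (psi t ` ?U)) (psi t)"
    unfolding embedding_map_def top subtopology_subtopology YY .
  let ?\<theta> = "\<lambda>x i. Arg (t i) + x (i mod d)"
  have smooth: "smooth_fun_on (d - 1) ?U (\<lambda>x. ?\<theta> x i)" for i
    by (intro smooth_fun_on_affine openin_dbox affine_fun_on_add affine_fun_on_coordinate dbox_subset)
       (rule affine_fun_on_const, rule refl)
  have "cis (Arg (t i)) = t i" if "i < n" for i
    using torus_norm[OF tT that] torus_nonzero[OF tT that] by (simp add: cis_Arg sgn_div_norm)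
  then have "twist n d t x = (\<lambda>i\<in>{..<n}. cis (?\<theta> x i))" for x
    by (auto simp: twist_def cis_mult[symmetric] fun_eq_iff)
  then have form: "psi t x = coset n (\<lambda>i\<in>{..<n}. cis (?\<theta> x i))" for x by simp
  have immersion: "v = (\<lambda>_. 0)"
    if v: "v \<in> topspace ?E"
      and deriv: "\<forall>i<n. ((\<lambda>s. ?\<theta> (\<lambda>j. x j + s * v j) i - ?\<theta> (\<lambda>j. x j + s * v j) 0)
                       has_real_derivative 0) (at 0)" for x v
  proof -
    have eq: "v (i mod d) = v 0" if "i < n" for i
    proof -
      have "((\<lambda>s. ?\<theta> (\<lambda>j. x j + s * v j) i - ?\<theta> (\<lambda>j. x j + s * v j) 0)
                       has_real_derivative (v (i mod d) - v 0)) (at 0)"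
        by (auto intro!: derivative_eq_intros)
      then show ?thesis using deriv that DERIV_unique by fastforce
    qed
    \<comment> \<open>The derivatives say that \<open>v\<close> is constant on the indices below
      \<open>d\<close>; the normalised last coordinate forces this constant to be 0.\<close>
    have "v (d - 1) = 0" using v by (simp add: topspace_Euclidean_space)
    then have "v 0 = 0" using eq[of "d - 1"] d_pos d_le by simp
    then have "v i = 0" for i
      using eq[of i] d_le v by (cases "i < d") (auto simp: topspace_Euclidean_space)
    then show ?thesis by auto
  qed
  show ?thesis
    unfolding smooth_param_def
    using openin_psi_image[OF t openin_dbox sub] hom smooth form immersion
    by (intro conjI exI[of _ ?\<theta>] allI impI ballI) blast+
qed

end

section \<open>Orbifold charts\<close>

context twisted
begin

abbreviation "orb \<equiv> orbit (integer_mod_group n) (cyc n)"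

abbreviation "YYt \<equiv> subtopology (torus_mod n) (YY n k \<omega>)"

lemma topspace_YYt: "topspace YYt = YY n k \<omega>"
  using YY_subset[of n k \<omega>] by auto

lemma action_YY: "continuous_action YYt (integer_mod_group n) (cyc n)"
  by (rule continuous_action.restrict_invariant[OF cyc_action[OF n]]) (rule cyc_YY[OF n])

lemma XX_conv: "XX n k \<omega> = orbit_space YYt (integer_mod_group n) (cyc n)"
  by (simp add: XX_def)

lemma topspace_XX: "topspace (XX n k \<omega>) = orb ` YY n k \<omega>"
  unfolding XX_conv topspace_orbit_space topspace_YYt ..

lemma continuous_map_orb: "continuous_map YYt (XX n k \<omega>) orb"
  unfolding XX_conv by (rule continuous_map_orbit)

lemma open_map_orb: "open_map YYt (XX n k \<omega>) orb"
  unfolding XX_conv by (rule continuous_action.open_map_orbit[OF action_YY])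

lemma orb_eq_iff:
  assumes "C \<in> YY n k \<omega>" "D \<in> YY n k \<omega>"
  shows "orb C = orb D \<longleftrightarrow> (\<exists>g. D = cyc n g C)"
proof -
  have "orb C = orb D \<longleftrightarrow> (\<exists>g\<in>carrier (integer_mod_group n). D = cyc n g C)"
    using continuous_action.orbit_eq_iff[OF action_YY] assms unfolding topspace_YYt by blast
  also have "\<dots> \<longleftrightarrow> D \<in> orb C" by (auto simp: orbit_def)
  finally show ?thesis by (auto simp: orbit_cyc[OF n])
qed

lemma XX_nonempty: "topspace (XX n k \<omega>) \<noteq> {}"
  using sol_nonempty by (auto simp: topspace_XX YY_conv)

lemma compact_XX: "compact_space (XX n k \<omega>)"
proof -
  have "compactin YYt (YY n k \<omega>)"
    using compactin_YY by (simp add: compactin_subtopology)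
  from image_compactin[OF this continuous_map_orb] show ?thesis
    by (simp add: compact_space_def topspace_XX)
qed

lemma connected_XX: "connected_space (XX n k \<omega>)"
proof -
  have "connectedin YYt (YY n k \<omega>)"
    using connectedin_YY by (simp add: connectedin_subtopology)
  from connectedin_continuous_map_image[OF continuous_map_orb this] show ?thesis
    by (simp add: connectedin_topspace[symmetric] topspace_XX)
qed

lemma Hausdorff_XX: "Hausdorff_space (XX n k \<omega>)"
  unfolding XX_conv
  by (intro continuous_action.Hausdorff_orbit_space action_YY finite_carrier_integer_mod_group n
      Hausdorff_space_subtopology Hausdorff_torus_mod)

section \<open>Stabilizers and isolating boxes\<close>

lemma cyc_psi:
  "t \<in> topspace (torus n) \<Longrightarrow> cyc n g (psi t x) = psi (cyc_torus n g t) (shift d g x)"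
  by (rule cyc_twist[OF n d_dvd(1)])

text \<open>A set of integers instead of residues, so that it is closed under ordinary sums and
  negatives.\<close>

definition stab :: "(nat \<Rightarrow> complex) \<Rightarrow> int set" where
  "stab t = {g. cyc n g (coset n t) = coset n t}"

text \<open>A rotation takes the parametrization based at \<open>t\<close> to the one based at the
  rotated \<open>t\<close>. For a stabilizing rotation both are the same map, and the rotation acts
  linearly on exponents.\<close>

lemma cyc_psi_stab:
  assumes t: "t \<in> sol n k \<omega>" and g: "g \<in> stab t"
  shows "cyc n g (psi t x) = psi t (shift d g x)"
proof -
  have "coset n (cyc_torus n g t) = coset n t" using g by (simp add: stab_def cyc_coset[OF n])
  then show ?thesis
    unfolding cyc_psi[OF sol_torus[OF t]]
    by (intro coset_twist_cong cyc_torus_in n sol_torus[OF t])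
qed

text \<open>A slice condition: rotations outside the stabilizer move the box off itself, so inside
  it orbits of the full group are orbits of the stabilizer. The bound \<pi> secures injectivity of
  \<open>psi t\<close>.\<close>

definition isolating :: "(nat \<Rightarrow> complex) \<Rightarrow> real \<Rightarrow> bool" where
  "isolating t \<epsilon> \<longleftrightarrow> 0 < \<epsilon> \<and> \<epsilon> \<le> pi \<and>
     (\<forall>g. \<forall>x\<in>dbox d \<epsilon>. \<forall>y\<in>dbox d \<epsilon>. cyc n g (psi t x) = psi t y \<longrightarrow> g \<in> stab t)"

lemma isolating_exists:
  assumes t: "t \<in> sol n k \<omega>" shows "\<exists>\<epsilon>. isolating t \<epsilon>"
proof -
  let ?E = "Euclidean_space (d - 1)"
  note tT = sol_torus[OF t]
  have "\<exists>\<epsilon>>0. \<forall>x\<in>dbox d \<epsilon>. \<forall>y\<in>dbox d \<epsilon>. cyc n g (psi t x) = psi t y \<longrightarrow> g \<in> stab t" for g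
  proof (cases "g \<in> stab t")
    \<comment> \<open>The conclusion holds for every radius here; 1 is an arbitrary choice.\<close>
    case True then show ?thesis by (auto intro: exI[of _ 1])
  next
    \<comment> \<open>The rotated coset differs from the original one, so disjoint neighbourhoods
      exist; pulled back along \<open>psi t\<close> and its rotation, they contain a box around
      0.\<close>
    case False
    have top: "coset n t \<in> topspace (torus_mod n)" "cyc n g (coset n t) \<in> topspace (torus_mod n)"
      using tT by (auto simp: topspace_torus_mod cyc_coset[OF n] cyc_torus_in[OF n])
    then obtain A B where AB: "openin (torus_mod n) A" "openin (torus_mod n) B"
        "coset n t \<in> A" "cyc n g (coset n t) \<in> B" "disjnt A B"
      using False Hausdorff_torus_mod[OF n, unfolded Hausdorff_space_def, rule_format, of "coset n t" "cyc n g (coset n t)"]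
      unfolding stab_def by auto
    have cont: "continuous_map ?E (torus_mod n) (psi t)" by (rule continuous_map_psi[OF tT])
    have "continuous_map ?E (torus_mod n) (\<lambda>x. cyc n g (psi t x))"
      unfolding cyc_psi[OF tT]
      using continuous_map_compose[OF continuous_map_shift[OF d_pos, of g] continuous_map_psi[OF cyc_torus_in[OF n tT, of g]]]
      by (simp add: o_def)
    note op = openin_Int[OF openin_continuous_map_preimage[OF cont AB(1)] openin_continuous_map_preimage[OF this AB(2)]]
    have "(\<lambda>_. 0) \<in> {x \<in> topspace ?E. psi t x \<in> A} \<inter> {x \<in> topspace ?E. cyc n g (psi t x) \<in> B}"
      using AB(3,4) by (simp add: topspace_Euclidean_space twist_0 tT)
    from dbox_neighbourhood[OF op this d_pos]
    obtain \<epsilon> where \<epsilon>: "\<epsilon> > 0"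
      "dbox d \<epsilon> \<subseteq> {x \<in> topspace ?E. psi t x \<in> A} \<inter> {x \<in> topspace ?E. cyc n g (psi t x) \<in> B}"
      by blast
    have "False" if "x \<in> dbox d \<epsilon>" "y \<in> dbox d \<epsilon>" "cyc n g (psi t x) = psi t y" for x y
    proof -
      have "psi t y \<in> A" "cyc n g (psi t x) \<in> B" using \<epsilon>(2) that(1,2) by auto
      then show False using AB(5) that(3) by (auto simp: disjnt_iff)
    qed
    then show ?thesis using \<epsilon>(1) by blast
  qed
  then obtain e where e: "\<And>g. e g > 0"
    "\<And>g x y. x \<in> dbox d (e g) \<Longrightarrow> y \<in> dbox d (e g) \<Longrightarrow> cyc n g (psi t x) = psi t y \<Longrightarrow> g \<in> stab t"
    by metis
  \<comment> \<open>Only residues modulo \<open>n\<close> matter for the action, so a minimum over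
    finitely many radii serves all integers.\<close>
  define \<epsilon> where "\<epsilon> = Min (insert pi (e ` {0..<int n}))"
  have "\<epsilon> > 0" unfolding \<epsilon>_def by (subst Min_gr_iff) (auto simp: e(1))
  moreover have "\<epsilon> \<le> pi" unfolding \<epsilon>_def by simp
  moreover have "g \<in> stab t" if xy: "x \<in> dbox d \<epsilon>" "y \<in> dbox d \<epsilon>" "cyc n g (psi t x) = psi t y" for g x y
  proof -
    let ?g = "g mod int n"
    have "\<epsilon> \<le> e ?g" unfolding \<epsilon>_def using n by (intro Min_le) auto
    then have "?g \<in> stab t"
      using e(2)[of x ?g y] xy dbox_mono[of \<epsilon> "e ?g" d] by (auto simp: cyc_mod)
    then show ?thesis by (simp add: stab_def cyc_mod)
  qed
  ultimately show ?thesis unfolding isolating_def by blast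
qed

text \<open>Integers congruent modulo \<open>d\<close> give the same map, so the set is finite
  although \<open>stab t\<close> is not. The restriction makes the maps extensional, as
  \<open>BijGroup\<close> demands.\<close>

definition chart_group :: "(nat \<Rightarrow> complex) \<Rightarrow> real \<Rightarrow> ((nat \<Rightarrow> real) \<Rightarrow> nat \<Rightarrow> real) set" where
  "chart_group t \<epsilon> = (\<lambda>g. restrict (shift d g) (dbox d \<epsilon>)) ` stab t"

definition chart :: "(nat \<Rightarrow> complex) \<Rightarrow> real \<Rightarrow> (nat \<Rightarrow> complex) set set orbifold_chart" where
  "chart t \<epsilon> = (dbox d \<epsilon>, chart_group t \<epsilon>, \<lambda>x. orb (psi t x))"

lemma stab_closed:
  assumes "t \<in> topspace (torus n)"
  shows "0 \<in> stab t" "g \<in> stab t \<Longrightarrow> h \<in> stab t \<Longrightarrow> g + h \<in> stab t" "g \<in> stab t \<Longrightarrow> - g \<in> stab t"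
proof -
  have top: "coset n t \<in> topspace (torus_mod n)" using assms by (auto simp: topspace_torus_mod)
  show "0 \<in> stab t" by (simp add: stab_def cyc_0[OF top n])
  show "g + h \<in> stab t" if "g \<in> stab t" "h \<in> stab t"
    using that by (simp add: stab_def cyc_add[OF n, symmetric])
  show "- g \<in> stab t" if "g \<in> stab t"
    using that cyc_add[OF n, of "- g" g "coset n t"] by (simp add: stab_def cyc_0[OF top n])
qed

lemma restrict_shift_Bij: "restrict (shift d g) (dbox d \<epsilon>) \<in> Bij (dbox d \<epsilon>)"
proof -
  have "bij_betw (shift d g) (dbox d \<epsilon>) (dbox d \<epsilon>)"
    using dbox_subset[of d \<epsilon>] shift_uminus[OF d_pos] shift_dbox[OF d_pos]
    by (intro bij_betw_byWitness[where f'="shift d (- g)"]) auto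
  then show ?thesis by (simp add: Bij_def bij_betw_restrict_eq)
qed

lemma subgroup_chart_group:
  assumes t: "t \<in> sol n k \<omega>" shows "subgroup (chart_group t \<epsilon>) (BijGroup (dbox d \<epsilon>))"
proof -
  let ?U = "dbox d \<epsilon>" and ?r = "\<lambda>g. restrict (shift d g) (dbox d \<epsilon>)"
  interpret B: group "BijGroup ?U" by (rule group_BijGroup)
  note stab = stab_closed[OF sol_torus[OF t]]
  have carrier: "?r g \<in> carrier (BijGroup ?U)" for g
    using restrict_shift_Bij by (simp add: BijGroup_def)
  have mult: "?r g \<otimes>\<^bsub>BijGroup ?U\<^esub> ?r h = ?r (g + h)" for g h
    using shift_dbox[OF d_pos]
    by (auto simp: BijGroup_def restrict_shift_Bij compose_def shift_add[OF d_pos] fun_eq_iff)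
  have one: "?r 0 = \<one>\<^bsub>BijGroup ?U\<^esub>"
    using dbox_subset[of d \<epsilon>] by (auto simp: BijGroup_def fun_eq_iff shift_0 subset_iff)
  have inv: "inv\<^bsub>BijGroup ?U\<^esub> (?r g) = ?r (- g)" for g
    using mult[of "- g" g] one carrier by (intro B.inv_equality) auto
  show ?thesis
  proof (rule B.subgroupI)
    show "chart_group t \<epsilon> \<noteq> {}" using stab(1) by (auto simp: chart_group_def)
  qed (use carrier stab in \<open>auto simp: chart_group_def mult inv\<close>)
qed

lemma finite_chart_group: "finite (chart_group t \<epsilon>)"
proof (rule finite_subset)
  have "restrict (shift d g) (dbox d \<epsilon>) = restrict (shift d (g mod int d)) (dbox d \<epsilon>)" for g
  proof -
    have "shift d (g mod int d) = shift d g" by (rule ext) (rule shift_mod)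
    then show ?thesis by simp
  qed
  moreover have "g mod int d \<in> {0..<int d}" for g using d_pos by simp
  ultimately show "chart_group t \<epsilon> \<subseteq> (\<lambda>g. restrict (shift d g) (dbox d \<epsilon>)) ` {0..<int d}"
    unfolding chart_group_def by blast
qed simp

text \<open>For the fibres, a rotation relating two points of the box is in the stabilizer by
  isolation, acts there as a shift, and injectivity of \<open>psi t\<close> transfers the relation
  to exponents. The quotient property comes from \<open>psi t\<close> and the orbit map being
  open.\<close>

lemma orbifold_chart_chart:
  assumes t: "t \<in> sol n k \<omega>" and iso: "isolating t \<epsilon>"
  shows "orbifold_chart (XX n k \<omega>) (d - 1) (chart t \<epsilon>)"
proof -
  let ?E = "Euclidean_space (d - 1)" and ?U = "dbox d \<epsilon>" and ?\<phi> = "\<lambda>x. orb (psi t x)"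
  have \<epsilon>: "0 < \<epsilon>" "\<epsilon> \<le> pi" using iso by (auto simp: isolating_def)
  have sub: "?U \<subseteq> dbox d pi" using \<epsilon>(2) by (rule dbox_mono)
  have top: "topspace (subtopology ?E ?U) = ?U" using dbox_subset[of d \<epsilon>] by auto
  have op: "openin (XX n k \<omega>) (?\<phi> ` V)" if "openin ?E V" "V \<subseteq> ?U" for V
  proof -
    have "openin YYt (psi t ` V)" using that sub by (intro openin_psi_image[OF t]) auto
    then show ?thesis using open_map_orb by (auto simp: open_map_def image_image)
  qed
  have cont: "continuous_map (subtopology ?E ?U) (XX n k \<omega>) ?\<phi>"
  proof -
    have "continuous_map (subtopology ?E ?U) YYt (psi t)"
      using continuous_map_psi[OF sol_torus[OF t]] psi_in[OF t]
      by (auto simp: continuous_map_in_subtopology continuous_map_from_subtopology)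
    from continuous_map_compose[OF this continuous_map_orb] show ?thesis by (simp add: o_def)
  qed
  have quot: "quotient_map (subtopology ?E ?U) (subtopology (XX n k \<omega>) (?\<phi> ` ?U)) ?\<phi>"
  proof (rule continuous_open_imp_quotient_map)
    show "continuous_map (subtopology ?E ?U) (subtopology (XX n k \<omega>) (?\<phi> ` ?U)) ?\<phi>"
      using cont top by (auto simp: continuous_map_in_subtopology)
    show "open_map (subtopology ?E ?U) (subtopology (XX n k \<omega>) (?\<phi> ` ?U)) ?\<phi>"
      unfolding open_map_def openin_open_subtopology[OF openin_dbox]
        openin_open_subtopology[OF op[OF openin_dbox order_refl]]
      using op by blast
    show "?\<phi> ` topspace (subtopology ?E ?U) = topspace (subtopology (XX n k \<omega>) (?\<phi> ` ?U))"
      unfolding top using openin_subset[OF op[OF openin_dbox order_refl]] by (simp add: Int_absorb1)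
  qed
  have fibres: "?\<phi> x = ?\<phi> y \<longleftrightarrow> (\<exists>g\<in>chart_group t \<epsilon>. y = g x)" if x: "x \<in> ?U" and y: "y \<in> ?U" for x y
  proof
    assume "?\<phi> x = ?\<phi> y"
    then obtain g where g: "psi t y = cyc n g (psi t x)"
      using orb_eq_iff psi_in[OF t] by blast
    then have "g \<in> stab t" using iso x y unfolding isolating_def by metis
    moreover have "y = shift d g x"
    proof (rule inj_onD[OF inj_on_psi[OF t]])
      show "psi t y = psi t (shift d g x)" using g cyc_psi_stab[OF t \<open>g \<in> stab t\<close>] by simp
    qed (use sub y shift_dbox[OF d_pos x, of g] in auto)
    ultimately show "\<exists>g\<in>chart_group t \<epsilon>. y = g x" using x by (auto simp: chart_group_def)
  next
    assume "\<exists>g\<in>chart_group t \<epsilon>. y = g x"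
    then obtain g where "g \<in> stab t" "y = shift d g x" using x by (auto simp: chart_group_def)
    then have "psi t y = cyc n g (psi t x)" using cyc_psi_stab[OF t] by simp
    then show "?\<phi> x = ?\<phi> y" using orb_eq_iff psi_in[OF t] by blast
  qed
  have smooth: "smooth_map_on (d - 1) ?U ?U g" if g: "g \<in> chart_group t \<epsilon>" for g
  proof -
    obtain h where h: "g = restrict (shift d h) ?U" using g by (auto simp: chart_group_def)
    have aff: "affine_fun_on (d - 1) ?U (\<lambda>x. g x j)" for j
    proof (rule affine_fun_on_cong)
      show "affine_fun_on (d - 1) ?U (\<lambda>x. shift d h x j)"
        by (intro affine_fun_on_shift affine_fun_on_coordinate dbox_subset)
    qed (simp add: h)
    have "g \<in> ?U \<rightarrow> ?U" using shift_dbox[OF d_pos] by (simp add: h)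
    then show ?thesis
      unfolding smooth_map_on_def using smooth_fun_on_affine[OF openin_dbox aff] by blast
  qed
  show ?thesis
    unfolding orbifold_chart_def chart_def prod.case
    using zero_in_dbox[OF \<epsilon>(1), of d] fibres
    by (intro conjI openin_dbox connectedin_dbox[OF \<epsilon>(1)] finite_chart_group subgroup_chart_group[OF t]
        ballI smooth op[OF openin_dbox order_refl] quot) blast+
qed

text \<open>Adding \<open>u\<close> to the exponents moves the base point from \<open>t\<close> to
  \<open>twist n d t u\<close>, whose coset is that of \<open>s\<close> rotated by \<open>g\<close>.
  The shift compensates this rotation, so corresponding points lie in one orbit.\<close>

lemma chart_embedding_translate:
  assumes s: "s \<in> sol n k \<omega>" and t: "t \<in> sol n k \<omega>" and u: "u \<in> dbox d \<epsilon>"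
    and \<delta>: "\<And>i j. i < d \<Longrightarrow> j < d \<Longrightarrow> \<bar>u i - u j\<bar> + \<delta> \<le> \<epsilon>"
    and g: "psi t u = cyc n g (coset n s)"
  shows "chart_embedding (d - 1) (chart s \<delta>) (chart t \<epsilon>) (\<lambda>w i. u i + shift d g w i)"
proof -
  have "orb (psi t (\<lambda>i. u i + shift d g w i)) = orb (psi s w)" for w
  proof -
    note sT = sol_torus[OF s] and tT = sol_torus[OF t]
    have "psi t (\<lambda>i. u i + shift d g w i) = psi (twist n d t u) (shift d g w)"
      by (simp add: twist_twist)
    also have "\<dots> = psi (cyc_torus n g s) (shift d g w)"
      using g by (intro coset_twist_cong twist_in_torus tT cyc_torus_in[OF n sT]) (simp add: cyc_coset[OF n])
    also have "\<dots> = cyc n g (psi s w)" by (simp add: cyc_psi[OF sT])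
    finally show ?thesis using orb_eq_iff psi_in s t by metis
  qed
  moreover have "smooth_open_embedding (d - 1) (dbox d \<delta>) (dbox d \<epsilon>) (\<lambda>w i. u i + shift d g w i)"
    using u by (intro smooth_open_embedding_dbox d_pos \<delta>) (auto simp: dbox_def)
  ultimately show ?thesis by (simp add: chart_embedding_def chart_def)
qed

text \<open>Finitely many strict bounds leave a common slack: \<open>\<epsilon>\<close> minus the
  largest difference.\<close>

lemma dbox_margin:
  assumes u: "u \<in> dbox d \<epsilon>"
  shows "\<exists>\<delta>>0. \<forall>i<d. \<forall>j<d. \<bar>u i - u j\<bar> + \<delta> \<le> \<epsilon>"
proof -
  define M where "M = Max ((\<lambda>(i, j). \<bar>u i - u j\<bar>) ` ({..<d} \<times> {..<d}))"
  have "M < \<epsilon>" unfolding M_def using d_pos u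
    by (subst Max_less_iff) (auto simp: dbox_def lessThan_empty_iff)
  moreover have "\<bar>u i - u j\<bar> \<le> M" if "i < d" "j < d" for i j
    unfolding M_def using that by (intro Max_ge) auto
  ultimately show ?thesis by (intro exI[of _ "\<epsilon> - M"]) fastforce
qed

lemma isolating_mono: "isolating t \<epsilon> \<Longrightarrow> 0 < \<delta> \<Longrightarrow> \<delta> \<le> \<epsilon> \<Longrightarrow> isolating t \<delta>"
  unfolding isolating_def using dbox_mono[of \<delta> \<epsilon> d] by (meson order_trans subsetD)

definition atlas :: "(nat \<Rightarrow> complex) set set orbifold_chart set" where
  "atlas = {chart t \<epsilon> | t \<epsilon>. t \<in> sol n k \<omega> \<and> isolating t \<epsilon>}"

lemma atlas_compatible:
  assumes t1: "t1 \<in> sol n k \<omega>" and t2: "t2 \<in> sol n k \<omega>"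
    and p: "p \<in> (\<lambda>x. orb (psi t1 x)) ` dbox d \<epsilon>1" "p \<in> (\<lambda>x. orb (psi t2 x)) ` dbox d \<epsilon>2"
  shows "\<exists>W K \<mu> f g. orbifold_chart (XX n k \<omega>) (d - 1) (W, K, \<mu>) \<and> p \<in> \<mu> ` W \<and>
           \<mu> ` W \<subseteq> (\<lambda>x. orb (psi t1 x)) ` dbox d \<epsilon>1 \<inter> (\<lambda>x. orb (psi t2 x)) ` dbox d \<epsilon>2 \<and>
           chart_embedding (d - 1) (W, K, \<mu>) (chart t1 \<epsilon>1) f \<and>
           chart_embedding (d - 1) (W, K, \<mu>) (chart t2 \<epsilon>2) g"
proof -
  obtain u1 u2 where u: "u1 \<in> dbox d \<epsilon>1" "u2 \<in> dbox d \<epsilon>2" "p = orb (psi t1 u1)" "p = orb (psi t2 u2)"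
    using p by blast
  \<comment> \<open>The third chart is centred over \<open>p\<close> itself. Its base point is a
    twist of \<open>t1\<close>, so the first embedding needs no rotation, while the second uses one
    that carries the coset of \<open>s\<close> to \<open>psi t2 u2\<close>.\<close>
  define s where "s = twist n d t1 u1"
  have s: "s \<in> sol n k \<omega>" unfolding s_def by (rule twist_sol[OF d_dvd t1])
  have top: "coset n s \<in> topspace (torus_mod n)" using sol_torus[OF s] by (auto simp: topspace_torus_mod)
  have g1: "psi t1 u1 = cyc n 0 (coset n s)" unfolding cyc_0[OF top n] by (simp add: s_def)
  obtain g where g2: "psi t2 u2 = cyc n g (coset n s)"
    using u(3,4) orb_eq_iff[OF psi_in[OF t1, of u1] psi_in[OF t2, of u2]] unfolding s_def by auto
  obtain \<epsilon> where \<epsilon>: "isolating s \<epsilon>" using isolating_exists[OF s] by blast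
  obtain \<delta>1 where \<delta>1: "\<delta>1 > 0" "\<forall>i<d. \<forall>j<d. \<bar>u1 i - u1 j\<bar> + \<delta>1 \<le> \<epsilon>1"
    using dbox_margin[OF u(1)] by blast
  obtain \<delta>2 where \<delta>2: "\<delta>2 > 0" "\<forall>i<d. \<forall>j<d. \<bar>u2 i - u2 j\<bar> + \<delta>2 \<le> \<epsilon>2"
    using dbox_margin[OF u(2)] by blast
  \<comment> \<open>Small enough to isolate at \<open>s\<close> and to fit into both boxes after
    translation.\<close>
  define \<delta> where "\<delta> = min \<epsilon> (min \<delta>1 \<delta>2)"
  have \<delta>: "\<delta> > 0" "\<delta> \<le> \<epsilon>" "\<delta> \<le> \<delta>1" "\<delta> \<le> \<delta>2"
    using \<delta>1(1) \<delta>2(1) \<epsilon> by (auto simp: \<delta>_def isolating_def)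
  have iso: "isolating s \<delta>" using isolating_mono[OF \<epsilon> \<delta>(1,2)] .
  have emb1: "chart_embedding (d - 1) (chart s \<delta>) (chart t1 \<epsilon>1) (\<lambda>w i. u1 i + shift d 0 w i)"
    by (rule chart_embedding_translate[OF s t1 u(1) _ g1]) (use \<delta>1(2) \<delta>(3) in force)
  have emb2: "chart_embedding (d - 1) (chart s \<delta>) (chart t2 \<epsilon>2) (\<lambda>w i. u2 i + shift d g w i)"
    by (rule chart_embedding_translate[OF s t2 u(2) _ g2]) (use \<delta>2(2) \<delta>(4) in force)
  have sub: "(\<lambda>x. orb (psi s x)) ` dbox d \<delta> \<subseteq> (\<lambda>x. orb (psi t x)) ` dbox d \<epsilon>'"
    if "chart_embedding (d - 1) (chart s \<delta>) (chart t \<epsilon>') f" for t \<epsilon>' f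
  proof clarify
    fix x assume x: "x \<in> dbox d \<delta>"
    have "f x \<in> dbox d \<epsilon>'" "orb (psi t (f x)) = orb (psi s x)"
      using that x by (auto simp: chart_embedding_def chart_def smooth_open_embedding_def smooth_map_on_def)
    then show "orb (psi s x) \<in> (\<lambda>x. orb (psi t x)) ` dbox d \<epsilon>'" by (metis imageI)
  qed
  have "p = orb (psi s (\<lambda>_. 0))" using u(3) sol_torus[OF s] by (simp add: twist_0 s_def)
  then have "p \<in> (\<lambda>x. orb (psi s x)) ` dbox d \<delta>" using zero_in_dbox[OF \<delta>(1)] by blast
  then show ?thesis
    using orbifold_chart_chart[OF s iso] emb1 emb2 Int_greatest[OF sub[OF emb1] sub[OF emb2]]
    unfolding chart_def[of s \<delta>] by (intro exI conjI) assumption+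
qed

lemma orbifold_XX: "orbifold (XX n k \<omega>) (d - 1) atlas"
  unfolding orbifold_def orbifold_atlas_def
proof (intro conjI Hausdorff_XX compact_imp_paracompact_space compact_XX)
  show "\<forall>c\<in>atlas. orbifold_chart (XX n k \<omega>) (d - 1) c"
    using orbifold_chart_chart by (auto simp: atlas_def)
  show "(\<Union>(U, G, \<phi>)\<in>atlas. \<phi> ` U) = topspace (XX n k \<omega>)"
  proof (intro equalityI subsetI)
    fix p assume "p \<in> (\<Union>(U, G, \<phi>)\<in>atlas. \<phi> ` U)"
    then obtain t x where "t \<in> sol n k \<omega>" "p = orb (psi t x)" by (auto simp: atlas_def chart_def)
    then show "p \<in> topspace (XX n k \<omega>)" unfolding topspace_XX using psi_in by blast
  next
    fix p assume "p \<in> topspace (XX n k \<omega>)"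
    then obtain t where t: "t \<in> sol n k \<omega>" "p = orb (coset n t)" by (auto simp: topspace_XX YY_conv)
    obtain \<epsilon> where \<epsilon>: "isolating t \<epsilon>" using isolating_exists[OF t(1)] by blast
    then have "(\<lambda>_. 0) \<in> dbox d \<epsilon>" by (auto simp: isolating_def zero_in_dbox)
    moreover have "p = orb (psi t (\<lambda>_. 0))" using t by (simp add: twist_0 sol_torus)
    ultimately have p: "p \<in> (case chart t \<epsilon> of (U, G, \<phi>) \<Rightarrow> \<phi> ` U)" unfolding chart_def prod.case by (intro image_eqI[where x="\<lambda>_. 0"])
    have "chart t \<epsilon> \<in> atlas"
      unfolding atlas_def by (intro CollectI exI[of _ t] exI[of _ \<epsilon>] conjI refl t(1) \<epsilon>)
    then show "p \<in> (\<Union>(U, G, \<phi>)\<in>atlas. \<phi> ` U)" using p by (rule UN_I)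
  qed
  show "\<forall>(U, G, \<phi>)\<in>atlas. \<forall>(V, H, \<psi>)\<in>atlas. \<forall>p\<in>\<phi> ` U \<inter> \<psi> ` V.
        \<exists>W K \<mu> f g. orbifold_chart (XX n k \<omega>) (d - 1) (W, K, \<mu>) \<and> p \<in> \<mu> ` W \<and> \<mu> ` W \<subseteq> \<phi> ` U \<inter> \<psi> ` V \<and>
          chart_embedding (d - 1) (W, K, \<mu>) (U, G, \<phi>) f \<and>
          chart_embedding (d - 1) (W, K, \<mu>) (V, H, \<psi>) g"
  proof (intro ballI case_prodI2)
    fix c c' U r G \<phi> V r' H \<psi> p
    assume "c \<in> atlas" "c = (U, r)" "r = (G, \<phi>)" "c' \<in> atlas" "c' = (V, r')" "r' = (H, \<psi>)"
      and p: "p \<in> \<phi> ` U \<inter> \<psi> ` V"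
    then obtain t1 \<epsilon>1 t2 \<epsilon>2 where c: "t1 \<in> sol n k \<omega>" "(U, G, \<phi>) = chart t1 \<epsilon>1"
      "t2 \<in> sol n k \<omega>" "(V, H, \<psi>) = chart t2 \<epsilon>2" by (auto simp: atlas_def)
    then have eq: "U = dbox d \<epsilon>1" "\<phi> = (\<lambda>x. orb (psi t1 x))" "V = dbox d \<epsilon>2" "\<psi> = (\<lambda>x. orb (psi t2 x))"
      by (auto simp: chart_def)
    show "\<exists>W K \<mu> f g. orbifold_chart (XX n k \<omega>) (d - 1) (W, K, \<mu>) \<and> p \<in> \<mu> ` W \<and> \<mu> ` W \<subseteq> \<phi> ` U \<inter> \<psi> ` V \<and>
          chart_embedding (d - 1) (W, K, \<mu>) (U, G, \<phi>) f \<and>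
          chart_embedding (d - 1) (W, K, \<mu>) (V, H, \<psi>) g"
      unfolding c(2,4) using atlas_compatible[OF c(1,3)] p unfolding eq by blast
  qed
qed

lemma charts_from_cover_atlas: "charts_from_cover n (YY n k \<omega>) (d - 1) atlas"
  unfolding charts_from_cover_def
proof clarify
  fix U G \<phi> assume "(U, G, \<phi>) \<in> atlas"
  then obtain t \<epsilon> where "t \<in> sol n k \<omega>" "isolating t \<epsilon>" "U = dbox d \<epsilon>" "\<phi> = (\<lambda>x. orb (psi t x))"
    by (auto simp: atlas_def chart_def)
  then show "\<exists>\<psi>. smooth_param n (YY n k \<omega>) (d - 1) U \<psi> \<and> (\<forall>x\<in>U. \<phi> x = orb (\<psi> x))"
    using smooth_param_psi by (auto simp: isolating_def)
qed

end

section \<open>The decomposition of the extended quotient\<close>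

lemma continuous_map_from_sum_topology:
  assumes "\<And>i. i \<in> I \<Longrightarrow> continuous_map (X i) Y (\<lambda>x. f (i, x))"
  shows "continuous_map (sum_topology X I) Y f"
  unfolding continuous_map_def
proof (intro conjI allI impI)
  show "f \<in> topspace (sum_topology X I) \<rightarrow> topspace Y"
    using assms continuous_map_image_subset_topspace by fastforce
  fix U assume U: "openin Y U"
  have "{x. (i, x) \<in> {p \<in> topspace (sum_topology X I). f p \<in> U}} = {x \<in> topspace (X i). f (i, x) \<in> U}" if "i \<in> I" for i
    using that by auto
  then show "openin (sum_topology X I) {p \<in> topspace (sum_topology X I). f p \<in> U}"
    unfolding openin_sum_topology using openin_continuous_map_preimage[OF assms U] by auto
qed

text \<open>Finiteness makes the disjoint union compact.\<close>

lemma finite_XX_index: assumes "n > 0" shows "finite (XX_index n)"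
proof (rule finite_subset)
  show "XX_index n \<subseteq> (SIGMA k:{1..n}. {\<omega>. \<omega> ^ (n div gcd k n) = 1})"
    by (auto simp: XX_index_def)
  show "finite (SIGMA k:{1..n}. {\<omega>::complex. \<omega> ^ (n div gcd k n) = 1})"
  proof (rule finite_SigmaI)
    fix k assume "k \<in> {1..n}"
    have "gcd k n \<le> n" using assms by (simp add: dvd_imp_le)
    \<comment> \<open>With exponent 0 every complex number would satisfy the equation.\<close>
    then have "n div gcd k n \<ge> 1" using assms by (simp add: Suc_le_eq div_greater_zero_iff)
    then show "finite {\<omega>::complex. \<omega> ^ (n div gcd k n) = 1}" by (rule finite_roots_unity)
  qed simp
qed

text \<open>Rotation by \<open>k\<close> multiplies a solution by the scalar \<omega>, so its coset
  does not move.\<close>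

lemma sol_fixed:
  assumes n: "n > 0" and \<omega>: "norm \<omega> = 1" and t: "t \<in> sol n k \<omega>"
  shows "cyc n (int k) (coset n t) = coset n t"
proof -
  have "cyc_torus n (int k) t = diag_act n \<omega> t"
  proof (rule torus_eqI[of _ n])
    show "diag_act n \<omega> t \<in> topspace (torus n)" using diag_act_sol[OF \<omega> t] sol_torus by blast
    fix i assume i: "i < n"
    have "(rot n (int k) i + k) mod n = i"
      using n i by (simp add: rot_uminus_nat[symmetric] rot_rot rot_0)
    then have "t i = inverse \<omega> * t (rot n (int k) i)" using sol_step[OF t rot_less[OF n], of "int k" i] by simp
    moreover have "\<omega> \<noteq> 0" using \<omega> by auto
    ultimately have "t (rot n (int k) i) = \<omega> * t i" by simp
    then show "cyc_torus n (int k) t i = diag_act n \<omega> t i" using i by (simp add: cyc_torus_apply diag_act_apply)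
  qed (intro cyc_torus_in n sol_torus[OF t])
  then show ?thesis by (simp add: cyc_coset[OF n] coset_diag_act \<omega> sol_torus[OF t])
qed

text \<open>A fixed coset yields a scalar by which rotation by \<open>k\<close> multiplies
  \<open>t\<close>. The root-of-unity condition on it arises by following coordinate 0 until the
  jumps by \<open>k\<close> return to it.\<close>

lemma fixed_imp_sol:
  assumes n: "n > 0" and t: "t \<in> topspace (torus n)" and fixed: "cyc n (int k) (coset n t) = coset n t"
  shows "\<exists>\<omega>. \<omega> ^ (n div gcd k n) = 1 \<and> t \<in> sol n k \<omega>"
proof -
  have "coset n (cyc_torus n (int k) t) = coset n t" using fixed by (simp add: cyc_coset[OF n])
  then obtain \<omega> where \<omega>: "norm \<omega> = 1" "cyc_torus n (int k) t = diag_act n \<omega> t"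
    using coset_eq_iff[OF cyc_torus_in[OF n t] t] by blast
  have step: "t ((i + k) mod n) = inverse \<omega> * t i" if i: "i < n" for i
  proof -
    have "rot n (int k) ((i + k) mod n) = i"
      using n i by (simp add: rot_uminus_nat[symmetric] rot_rot rot_0)
    then have "t i = \<omega> * t ((i + k) mod n)"
      using fun_cong[OF \<omega>(2), of "(i + k) mod n"] n by (simp add: cyc_torus_apply diag_act_apply)
    moreover have "\<omega> \<noteq> 0" using \<omega>(1) by auto
    ultimately show ?thesis by simp
  qed
  have iter: "t ((j * k) mod n) = inverse \<omega> ^ j * t 0" for j
  proof (induction j)
    case (Suc j)
    have "t ((Suc j * k) mod n) = t (((j * k) mod n + k) mod n)"
      by (simp add: mod_simps add.commute)
    also have "\<dots> = inverse \<omega> * t ((j * k) mod n)" using n by (intro step) simp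
    finally show ?case using Suc by simp
  qed simp
  \<comment> \<open>After this many jumps of length \<open>k\<close> the index is a multiple of
    \<open>n\<close>, hence 0 again.\<close>
  have "(n div gcd k n) * k = n * (k div gcd k n)"
    by (metis div_mult_swap dvd_div_mult gcd_dvd1 gcd_dvd2 mult.commute)
  then have "inverse \<omega> ^ (n div gcd k n) * t 0 = t 0" using iter[of "n div gcd k n"] by simp
  then have "inverse (\<omega> ^ (n div gcd k n)) = 1" using torus_nonzero[OF t n] by (simp add: power_inverse)
  then have "\<omega> ^ (n div gcd k n) = 1" using inverse_eq_1_iff by blast
  then show ?thesis using step t by (auto simp: sol_def)
qed

text \<open>Keeps the pieces belonging to one \<open>k\<close> and different scalars apart.\<close>

lemma sol_inj:
  assumes "n > 0" "t \<in> sol n k \<omega>" "t \<in> sol n k \<omega>'" shows "\<omega> = \<omega>'"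
proof -
  have "inverse \<omega> * t 0 = inverse \<omega>' * t 0"
    using assms sol_step[of t n k _ 0] by metis
  then show ?thesis using torus_nonzero[OF sol_torus[OF assms(2)] assms(1)] by simp
qed

lemma twisted_XX_index: "n > 0 \<Longrightarrow> (k, \<omega>) \<in> XX_index n \<Longrightarrow> twisted n k (gcd k n) \<omega>"
  by unfold_locales (auto simp: XX_index_def)

text \<open>The group leaves the second component alone. This is why the decomposition sends an
  orbit \<open>p\<close> to a product of \<open>p\<close> with a singleton.\<close>

lemma orbit_ext:
  "orbit G (\<lambda>g (x, c). (\<alpha> g x, c)) (x, c) = orbit G \<alpha> x \<times> {c}"
  by (auto simp: orbit_def)

lemma topspace_ext_quotient_cyc:
  "topspace (ext_quotient (torus_mod n) (integer_mod_group n) (cyc n)) =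
     {orbit (integer_mod_group n) (cyc n) C \<times> {c} | C c.
        C \<in> topspace (torus_mod n) \<and> c \<in> carrier (integer_mod_group n) \<and> cyc n c C = C}"
proof -
  let ?F = "{p \<in> topspace (torus_mod n) \<times> carrier (integer_mod_group n). cyc n (snd p) (fst p) = fst p}"
  have "topspace (ext_space (torus_mod n) (integer_mod_group n) (cyc n)) = ?F"
    by (auto simp: ext_space_def)
  moreover have "orbit (integer_mod_group n) (\<lambda>g (x, c). (cyc n g x, c)) p =
      orbit (integer_mod_group n) (cyc n) (fst p) \<times> {snd p}" for p :: "_ \<times> int"
    using orbit_ext[of _ "cyc n" "fst p" "snd p"] by simp
  ultimately show ?thesis unfolding ext_quotient_def topspace_orbit_space
    by (auto simp: image_iff; blast)
qed

text \<open>Compactness spares a proof that the inverse, which has to find the scalar \<omega> of a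
  fixed coset, is continuous.\<close>

lemma ext_quotient_decomposition:
  assumes n: "n > 0"
  shows "homeomorphic_map
           (sum_topology (\<lambda>(k, \<omega>). XX n k \<omega>) (XX_index n))
           (ext_quotient (torus_mod n) (integer_mod_group n) (cyc n))
           (\<lambda>((k, \<omega>), p). p \<times> {int k mod int n})"
    (is "homeomorphic_map ?S ?Q ?f")
proof (rule continuous_imp_homeomorphic_map)
  let ?G = "integer_mod_group n" and ?X = "torus_mod n"
  interpret cyc: continuous_action ?X ?G "cyc n" by (rule cyc_action[OF n])
  have ext: "continuous_action (ext_space ?X ?G (cyc n)) ?G (\<lambda>g (x, c). (cyc n g x, c))"
    by (rule cyc.ext_space_action) (simp add: add.commute)
  note tw = twisted_XX_index[OF n]
  have mod_carrier: "int k mod int n \<in> carrier ?G" for k using n by (simp add: carrier_integer_mod_group)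
  have fixed: "cyc n (int k mod int n) C = C" if "(k, \<omega>) \<in> XX_index n" "C \<in> YY n k \<omega>" for k \<omega> C
    using that sol_fixed[OF n twisted.norm_omega[OF tw[OF that(1)]]] by (auto simp: YY_conv cyc_mod)
  show "continuous_map ?S ?Q ?f"
  proof (rule continuous_map_from_sum_topology)
    fix i assume i: "i \<in> XX_index n"
    obtain k \<omega> where k\<omega>: "i = (k, \<omega>)" by fastforce
    let ?c = "int k mod int n" and ?Y = "subtopology ?X (YY n k \<omega>)"
    have "continuous_map ?Y (prod_topology ?X (discrete_topology (carrier ?G))) (\<lambda>C. (C, ?c))"
      using mod_carrier by (intro continuous_map_pairedI) (auto simp: continuous_map_from_subtopology)
    then have "continuous_map ?Y (ext_space ?X ?G (cyc n)) (\<lambda>C. (C, ?c))"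
      unfolding ext_space_def continuous_map_in_subtopology using fixed i unfolding k\<omega> by auto
    from continuous_map_compose[OF this continuous_map_orbit[of _ ?G "\<lambda>g (x, c). (cyc n g x, c)"]]
    have "continuous_map ?Y ?Q ((\<lambda>p. p \<times> {?c}) \<circ> orbit ?G (cyc n))"
      unfolding ext_quotient_def by (simp add: o_def orbit_ext)
    then have "continuous_map (XX n k \<omega>) ?Q (\<lambda>p. p \<times> {?c})"
      unfolding XX_def orbit_space_def continuous_compose_quotient_map_eq[OF quotient_map_quotient_topology] .
    then show "continuous_map (case i of (k, \<omega>) \<Rightarrow> XX n k \<omega>) ?Q (\<lambda>p. ?f (i, p))" by (simp add: k\<omega>)
  qed
  show "compact_space ?S"
    using twisted.compact_XX[OF tw] by (intro compact_space_sum_topology finite_XX_index n) auto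
  show "Hausdorff_space ?Q"
    unfolding ext_quotient_def
    by (intro continuous_action.Hausdorff_orbit_space[OF ext] finite_carrier_integer_mod_group n)
       (auto simp: ext_space_def Hausdorff_space_prod_topology Hausdorff_torus_mod[OF n] intro: Hausdorff_space_subtopology)
  show "?f ` topspace ?S = topspace ?Q"
  proof (intro equalityI subsetI)
    fix q assume "q \<in> ?f ` topspace ?S"
    then obtain k \<omega> p where q: "(k, \<omega>) \<in> XX_index n" "p \<in> topspace (XX n k \<omega>)" "q = p \<times> {int k mod int n}"
      by auto
    then obtain C where "C \<in> YY n k \<omega>" "p = orbit ?G (cyc n) C"
      using twisted.topspace_XX[OF tw] by blast
    then show "q \<in> topspace ?Q"
      unfolding topspace_ext_quotient_cyc q(3)
      using fixed[OF q(1)] YY_subset mod_carrier by blast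
  next
    fix q assume "q \<in> topspace ?Q"
    then obtain t c where t: "t \<in> topspace (torus n)" "c \<in> carrier ?G" "cyc n c (coset n t) = coset n t"
      and q: "q = orbit ?G (cyc n) (coset n t) \<times> {c}"
      unfolding topspace_ext_quotient_cyc topspace_torus_mod by blast
    have c: "0 \<le> c" "c < int n" using t(2) n by (auto simp: carrier_integer_mod_group)
    \<comment> \<open>Indices run from 1 to \<open>n\<close>, residues from 0 to n - 1; the identity
      of the group is represented by \<open>k = n\<close>.\<close>
    define k where "k = (if c = 0 then n else nat c)"
    have k: "1 \<le> k" "k \<le> n" "int k mod int n = c" using c n by (auto simp: k_def)
    then have "cyc n (int k) (coset n t) = coset n t" using t(3) cyc_mod[of n "int k"] by simp
    then obtain \<omega> where \<omega>: "\<omega> ^ (n div gcd k n) = 1" "t \<in> sol n k \<omega>"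
      using fixed_imp_sol[OF n t(1)] by blast
    then have i: "(k, \<omega>) \<in> XX_index n" using k by (simp add: XX_index_def)
    have "coset n t \<in> YY n k \<omega>" using \<omega>(2) by (simp add: coset_in_YY[OF t(1)])
    then have "orbit ?G (cyc n) (coset n t) \<in> topspace (XX n k \<omega>)"
      unfolding twisted.topspace_XX[OF tw[OF i]] by (rule imageI)
    then have "((k, \<omega>), orbit ?G (cyc n) (coset n t)) \<in> topspace ?S" using i by simp
    moreover have "q = ?f ((k, \<omega>), orbit ?G (cyc n) (coset n t))" using q k(3) by simp
    ultimately show "q \<in> ?f ` topspace ?S" by (rule rev_image_eqI)
  qed
  show "inj_on ?f (topspace ?S)"
  proof (rule inj_onI)
    fix a b assume ab: "a \<in> topspace ?S" "b \<in> topspace ?S" "?f a = ?f b"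
    obtain k \<omega> p k' \<omega>' p' where eq: "a = ((k, \<omega>), p)" "b = ((k', \<omega>'), p')" by (metis surj_pair)
    have i: "(k, \<omega>) \<in> XX_index n" "(k', \<omega>') \<in> XX_index n" using ab(1,2) unfolding eq by simp_all
    have "p \<in> topspace (XX n k \<omega>)" "p' \<in> topspace (XX n k' \<omega>')" using ab(1,2) unfolding eq by simp_all
    then have "p \<in> orbit ?G (cyc n) ` YY n k \<omega>" "p' \<in> orbit ?G (cyc n) ` YY n k' \<omega>'"
      unfolding twisted.topspace_XX[OF tw[OF i(1)]] twisted.topspace_XX[OF tw[OF i(2)]] .
    then obtain C C' where C: "C \<in> YY n k \<omega>" "p = orbit ?G (cyc n) C"
        and C': "C' \<in> YY n k' \<omega>'" "p' = orbit ?G (cyc n) C'"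
      by (elim imageE)
    have CX: "C \<in> topspace ?X" "C' \<in> topspace ?X"
      by (rule subsetD[OF YY_subset C(1)], rule subsetD[OF YY_subset C'(1)])
    \<comment> \<open>Since \<open>p\<close> is nonempty, both factors can be read off from the
      product.\<close>
    have "C \<in> p" using cyc.orbit_self[OF CX(1)] unfolding C(2) .
    then have p: "p = p'" and kk': "int k mod int n = int k' mod int n"
      using ab(3) unfolding eq prod.case times_eq_iff by auto
    have "k = k'"
    proof -
      have "k \<in> {1..n}" "k' \<in> {1..n}" "k mod n = k' mod n"
        using i kk' by (auto simp: XX_index_def zmod_int[symmetric])
      then show ?thesis by (cases "k = n"; cases "k' = n") auto
    qed
    have "orbit ?G (cyc n) C = orbit ?G (cyc n) C'" using p unfolding C(2) C'(2) .
    then obtain g where "C' = cyc n g C" using cyc.orbit_eq_iff[OF CX] by blast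
    \<comment> \<open>As \<open>YY\<close> is invariant under rotation, a single representative of
      \<open>C'\<close> solves the equations for both scalars, so these agree.\<close>
    then have "C' \<in> YY n k \<omega>" using cyc_YY[OF n C(1)] by simp
    then obtain t where t: "t \<in> sol n k \<omega>" "C' = coset n t" unfolding YY_conv by (rule imageE)
    then have "t \<in> sol n k' \<omega>'" using C'(1) coset_in_YY[OF sol_torus[OF t(1)]] by simp
    then have "\<omega> = \<omega>'" using sol_inj[OF n t(1)] \<open>k = k'\<close> by simp
    then show "a = b" using \<open>k = k'\<close> p by (simp add: eq)
  qed
qed

theorem theorem1p1:
  fixes n :: nat
  assumes "n \<ge> 1"
  shows "homeomorphic_map
           (sum_topology (\<lambda>(k, \<omega>). XX n k \<omega>) (XX_index n))
           (ext_quotient (torus_mod n) (integer_mod_group n) (cyc n))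
           (\<lambda>((k, \<omega>), p). p \<times> {int k mod int n})
       \<and> (\<forall>(k, \<omega>)\<in>XX_index n.
            topspace (XX n k \<omega>) \<noteq> {} \<and> compact_space (XX n k \<omega>) \<and> connected_space (XX n k \<omega>) \<and>
            (\<exists>m A. orbifold (XX n k \<omega>) m A \<and> charts_from_cover n (YY n k \<omega>) m A))"
proof (intro conjI ballI case_prodI2)
  have n: "n > 0" using assms by simp
  then show "homeomorphic_map
           (sum_topology (\<lambda>(k, \<omega>). XX n k \<omega>) (XX_index n))
           (ext_quotient (torus_mod n) (integer_mod_group n) (cyc n))
           (\<lambda>((k, \<omega>), p). p \<times> {int k mod int n})"
    by (rule ext_quotient_decomposition)
  fix i k \<omega> assume "i \<in> XX_index n" "i = (k, \<omega>)"
  then interpret twisted n k "gcd k n" \<omega> using twisted_XX_index[OF n] by simp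
  show "topspace (XX n k \<omega>) \<noteq> {}" "compact_space (XX n k \<omega>)" "connected_space (XX n k \<omega>)"
    by (rule XX_nonempty compact_XX connected_XX)+
  show "\<exists>m A. orbifold (XX n k \<omega>) m A \<and> charts_from_cover n (YY n k \<omega>) m A"
    using orbifold_XX charts_from_cover_atlas by blast
qed

end
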